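(* Let $\langle B_n\rangle_{n=0}^\infty$ be an enumeration of the finite image partition regular matrices with rational entries. Let $p$ be a minimal idempotent in $(\beta\mathbb N,+)$ and let $A\in p$. Then there exist $b\in\mathbb N$ and a sequence $\langle Y_n\rangle_{n=0}^\infty$ in $\mathcal P_f(\mathbb N)$ such that each $Y_n$ is the set of entries of an image of $B_n$ (that is, with $B_n$ a $u(n)\times v(n)$ matrix, $Y_n$ is the set of entries of $B_n\vec x$ for some $\vec x\in\mathbb N^{v(n)}$) and $$FS(\langle Y_n\rangle_{n=0}^\infty)\cup\big(b+MT(\langle 2,1\rangle,\langle Y_n\rangle_{n=0}^\infty)\big)\subseteq A.$$
   Context: $\mathbb N=\{1,2,3,\ldots\}$, $\omega=\{0,1,2,\ldots\}$. For a set $X$, $\mathcal P_f(X)$ is the set of finite nonempty subsets of $X$. For $F,G\in\mathcal P_f(\omega)$, $F<G$ means $\max F<\min G$. A matrix $B$ with rational entries is image partition regular (IPR) if, whenever $\mathbb N$ is finitely coloured, there is a vector $\vec x$ with entries in $\mathbb N$ such that all entries of $B\vec x$ are natural numbers of the same colour. For finite nonempty sets $Y_n\subseteq\mathbb Q$ ($n<\omega$): $FS(\langle Y_n\rangle_{n=0}^\infty)=\{\sum_{n\in F}x_n: F\in\mathcal P_f(\omega)\text{ and }x_n\in Y_n\text{ for each }n\in F\}$; and $MT(\langle 2,1\rangle,\langle Y_n\rangle_{n=0}^\infty)=\{2\sum_{t\in F_0}x_t+\sum_{t\in F_1}x_t: F_0,F_1\in\mathcal P_f(\omega),\ F_0<F_1,\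 x_t\in Y_t\text{ for each }t\in F_0\cup F_1\}$. For $b\in\mathbb N$, $b+X=\{b+x:x\in X\}$. $\beta\mathbb N$ is the Stone–Čech compactification of the discrete space $\mathbb N$, viewed as the set of ultrafilters on $\mathbb N$, with addition given by: $A\in p+q$ if and only if $\{x\in\mathbb N:-x+A\in q\}\in p$, where $-x+A=\{y\in\mathbb N:x+y\in A\}$. This is a compact Hausdorff right topological semigroup, having a smallest two-sided ideal $K(\beta\mathbb N)$; a minimal idempotent is an idempotent $p=p+p$ belonging to $K(\beta\mathbb N)$. *)

theory Defs
  imports Complex_Main "Jordan_Normal_Form.Matrix"
begin

section \<open>Natural numbers and finite nonempty sets\<close>

(* The positive integers; the type nat itself plays the role of omega = {0, 1, 2, ...}. *)
definition posN :: "nat set" where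
  "posN = {n. 0 < n}"

definition Pf :: "'a set \<Rightarrow> 'a set set" where
  "Pf X = {F. F \<subseteq> X \<and> finite F \<and> F \<noteq> {}}"

definition set_less :: "nat set \<Rightarrow> nat set \<Rightarrow> bool" where
  "set_less F G \<longleftrightarrow> Max F < Min G"

section \<open>Image partition regularity\<close>

definition image_vec :: "rat mat \<Rightarrow> nat vec \<Rightarrow> rat vec" where
  "image_vec B x = B *\<^sub>v map_vec of_nat x"

definition posN_vec :: "nat \<Rightarrow> nat vec set" where
  "posN_vec v = {x \<in> carrier_vec v. \<forall>j<v. x $ j \<in> posN}"

(* A finite colouring is a function c taking finitely many values on posN.
   Matrices are required to have at least one row and one column: a matrix with no rows would
   satisfy the condition vacuously, and its images have no entries. *)
definition image_partition_regular :: "rat mat \<Rightarrow> bool" where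
  "image_partition_regular B \<longleftrightarrow>
     0 < dim_row B \<and> 0 < dim_col B \<and>
     (\<forall>c :: nat \<Rightarrow> nat. finite (c ` posN) \<longrightarrow>
        (\<exists>x \<in> posN_vec (dim_col B). \<exists>k.
           \<forall>i < dim_row B. \<exists>m \<in> posN. image_vec B x $ i = of_nat m \<and> c m = k))"

section \<open>Finite sums and Milliken-Taylor systems\<close>

(* FS and MT21 are polymorphic so as to cover both sets of rationals and sets of naturals. *)
definition FS :: "(nat \<Rightarrow> 'a::comm_semiring_1 set) \<Rightarrow> 'a set" where
  "FS Y = {(\<Sum>n\<in>F. x n) | F x. F \<in> Pf UNIV \<and> (\<forall>n\<in>F. x n \<in> Y n)}"

(* The Milliken-Taylor system with coefficient sequence (2, 1). *)
definition MT21 :: "(nat \<Rightarrow> 'a::comm_semiring_1 set) \<Rightarrow> 'a set" where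
  "MT21 Y = {2 * (\<Sum>t\<in>F0. x t) + (\<Sum>t\<in>F1. x t) | F0 F1 x.
     F0 \<in> Pf UNIV \<and> F1 \<in> Pf UNIV \<and> set_less F0 F1 \<and> (\<forall>t \<in> F0 \<union> F1. x t \<in> Y t)}"

section \<open>The semigroup of ultrafilters on the positive integers\<close>

(* Ultrafilters on posN (not on the type nat): every member is a subset of posN. *)
definition betaN :: "nat set set set" where
  "betaN = {p. p \<subseteq> Pow posN \<and> posN \<in> p \<and> {} \<notin> p \<and>
     (\<forall>A\<in>p. \<forall>B\<in>p. A \<inter> B \<in> p) \<and>
     (\<forall>A\<in>p. \<forall>B. A \<subseteq> B \<and> B \<subseteq> posN \<longrightarrow> B \<in> p) \<and>
     (\<forall>A. A \<subseteq> posN \<longrightarrow> A \<in> p \<or> posN - A \<in> p)}"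

definition shift_back :: "nat \<Rightarrow> nat set \<Rightarrow> nat set" where
  "shift_back x A = {y \<in> posN. x + y \<in> A}"

definition beta_plus :: "nat set set \<Rightarrow> nat set set \<Rightarrow> nat set set" where
  "beta_plus p q = {A. A \<subseteq> posN \<and> {x \<in> posN. shift_back x A \<in> q} \<in> p}"

definition two_sided_ideal :: "nat set set set \<Rightarrow> bool" where
  "two_sided_ideal I \<longleftrightarrow> I \<subseteq> betaN \<and> I \<noteq> {} \<and>
     (\<forall>p\<in>betaN. \<forall>q\<in>I. beta_plus p q \<in> I \<and> beta_plus q p \<in> I)"

(* K(betaN), the least two-sided ideal with respect to inclusion.  It exists because
   betaN is a compact Hausdorff right topological semigroup. *)
definition K_betaN :: "nat set set set" where
  "K_betaN = (LEAST I. two_sided_ideal I)"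

definition minimal_idempotent :: "nat set set \<Rightarrow> bool" where
  "minimal_idempotent p \<longleftrightarrow> p \<in> betaN \<and> beta_plus p p = p \<and> p \<in> K_betaN"

end

theory Submission
  imports Defs
begin

text \<open>
  A point \<open>p\<close> of \<open>K(\<beta>\<nat>)\<close> satisfies \<open>p = r + (q + p)\<close> with a suitable \<open>r\<close>, for every \<open>q\<close>.  With
  \<open>q = 2p\<close> this gives a \<open>b\<close> such that \<open>-b + A\<close> belongs to \<open>2p + p\<close>, and then the sets \<open>Y n\<close> are
  chosen one after the other by the usual idempotent argument, provided that every member of \<open>p\<close>
  contains an image of every image partition regular matrix \<open>M\<close>.

  To see the latter, colour \<open>y\<close> by \<open>\<lfloor>N ln y\<rfloor> mod N\<^sup>2\<close>: the entries of a monochromatic image are pairwise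
  either nearly equal or of very different size.  As \<open>N\<close> grows, the normalised values of the rows of
  \<open>M\<close> and of the coordinates converge along a subsequence; a rational point near the limit gives an
  integer vector \<open>w\<close> on which these linear forms are nonnegative, not all zero, and where the nonzero
  row values share one value \<open>c\<close>.  By induction the forms vanishing at \<open>w\<close> can be solved in all
  members of \<open>p\<close>, hence along a whole finite sums system, and an IP van der Waerden theorem for
  members of \<open>p\<close> yields a multiple of \<open>w\<close> which, added to such a solution, moves the remaining rows
  into \<open>A\<close> as well.
\<close>

section \<open>Translates of sets of positive integers\<close>

lemma shift_back_subset: "shift_back x A \<subseteq> posN"
  by (auto simp: shift_back_def)

lemma shift_back_Int: "shift_back x (A \<inter> B) = shift_back x A \<inter> shift_back x B"
  by (auto simp: shift_back_def)

lemma shift_back_Compl: "shift_back x (posN - A) = posN - shift_back x A"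
  by (auto simp: shift_back_def posN_def)

lemma shift_back_shift_back: "shift_back x (shift_back y A) = shift_back (x + y) A"
  by (auto simp: shift_back_def posN_def ac_simps)

lemma shift_back_posN: "shift_back x posN = posN"
  by (auto simp: shift_back_def posN_def)

lemma shift_back_empty: "shift_back x {} = {}"
  by (auto simp: shift_back_def)

lemma shift_back_mono: "A \<subseteq> B \<Longrightarrow> shift_back x A \<subseteq> shift_back x B"
  by (auto simp: shift_back_def)

lemma shift_back_0: "A \<subseteq> posN \<Longrightarrow> shift_back 0 A = A"
  by (auto simp: shift_back_def)

section \<open>Filters and ultrafilters on the positive integers\<close>

definition proper_filter :: "nat set set \<Rightarrow> bool" where
  "proper_filter F \<longleftrightarrow> F \<subseteq> Pow posN \<and> posN \<in> F \<and> {} \<notin> F \<and>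
     (\<forall>A\<in>F. \<forall>B\<in>F. A \<inter> B \<in> F) \<and> (\<forall>A\<in>F. \<forall>B. A \<subseteq> B \<and> B \<subseteq> posN \<longrightarrow> B \<in> F)"

lemma betaN_iff:
  "p \<in> betaN \<longleftrightarrow> proper_filter p \<and> (\<forall>A. A \<subseteq> posN \<longrightarrow> A \<in> p \<or> posN - A \<in> p)"
  unfolding betaN_def proper_filter_def by simp

lemma filter_subset: "proper_filter F \<Longrightarrow> A \<in> F \<Longrightarrow> A \<subseteq> posN"
  by (auto simp: proper_filter_def)

lemma filter_posN: "proper_filter F \<Longrightarrow> posN \<in> F"
  by (simp add: proper_filter_def)

lemma filter_Int: "proper_filter F \<Longrightarrow> A \<in> F \<Longrightarrow> B \<in> F \<Longrightarrow> A \<inter> B \<in> F"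
  by (simp add: proper_filter_def)

lemma filter_mono: "proper_filter F \<Longrightarrow> A \<in> F \<Longrightarrow> A \<subseteq> B \<Longrightarrow> B \<subseteq> posN \<Longrightarrow> B \<in> F"
  unfolding proper_filter_def by blast

lemma filter_nonempty: "proper_filter F \<Longrightarrow> A \<in> F \<Longrightarrow> A \<noteq> {}"
  by (auto simp: proper_filter_def)

lemma filter_INT:
  assumes "proper_filter F" "finite I" "\<And>i. i \<in> I \<Longrightarrow> B i \<in> F"
  shows "posN \<inter> (\<Inter>i\<in>I. B i) \<in> F"
  using assms(2,3)
proof (induction I)
  case empty
  then show ?case using assms(1) by (simp add: filter_posN)
next
  case (insert i I)
  have "posN \<inter> (\<Inter>i\<in>insert i I. B i) = B i \<inter> (posN \<inter> (\<Inter>i\<in>I. B i))"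
    by auto
  then show ?case using insert filter_Int[OF assms(1)] by simp
qed

lemma betaN_filter: "p \<in> betaN \<Longrightarrow> proper_filter p"
  by (simp add: betaN_iff)

lemma betaN_Compl_iff:
  assumes "p \<in> betaN" "A \<subseteq> posN"
  shows "posN - A \<in> p \<longleftrightarrow> A \<notin> p"
proof -
  have "A \<in> p \<or> posN - A \<in> p" and f: "proper_filter p" using assms unfolding betaN_iff by blast+
  moreover have "A \<inter> (posN - A) = {}" by auto
  ultimately show ?thesis
    using filter_Int[OF f, of A "posN - A"] filter_nonempty[OF f, of "{}"] by metis
qed

lemma betaN_eqI:
  assumes "p \<in> betaN" "q \<in> betaN" "p \<subseteq> q"
  shows "p = q"
proof (rule antisym[OF assms(3)], rule)
  fix A assume A: "A \<in> q"
  have "A \<subseteq> posN" using A assms(2) by (meson betaN_filter filter_subset)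
  then show "A \<in> p" using A assms betaN_Compl_iff by blast
qed

text \<open>The parameter \<open>T\<close> lets one application of Zorn's lemma serve twice:
  \<open>T = {}\<close> imposes nothing and leads to ultrafilters, \<open>T = posN\<close> gives the
  invariant filters behind minimal left ideals.\<close>

definition shift_closed :: "nat set \<Rightarrow> nat set set \<Rightarrow> bool" where
  "shift_closed T F \<longleftrightarrow> (\<forall>n\<in>T. \<forall>A\<in>F. shift_back n A \<in> F)"

lemma maximal_shift_closed_filter:
  assumes "proper_filter F0" "shift_closed T F0"
  obtains F where "F0 \<subseteq> F" "proper_filter F" "shift_closed T F"
    "\<And>G. proper_filter G \<Longrightarrow> shift_closed T G \<Longrightarrow> F \<subseteq> G \<Longrightarrow> G = F"
proof -
  let ?A = "{F. F0 \<subseteq> F \<and> proper_filter F \<and> shift_closed T F}"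
  have "\<exists>M\<in>?A. \<forall>X\<in>?A. M \<subseteq> X \<longrightarrow> X = M"
  proof (rule subset_Zorn_nonempty)
    show "?A \<noteq> {}" using assms by blast
  next
    fix \<C> assume ne: "\<C> \<noteq> {}" and ch: "subset.chain ?A \<C>"
    have C: "F0 \<subseteq> F" "proper_filter F" "shift_closed T F" if "F \<in> \<C>" for F
      using ch that unfolding subset.chain_def by blast+
    have lin: "F \<subseteq> G \<or> G \<subseteq> F" if "F \<in> \<C>" "G \<in> \<C>" for F G
      using ch that unfolding subset.chain_def by blast
    have "proper_filter (\<Union>\<C>)"
      unfolding proper_filter_def
    proof (intro conjI ballI allI impI)
      show "\<Union>\<C> \<subseteq> Pow posN" using filter_subset[OF C(2)] by blast
      show "posN \<in> \<Union>\<C>" using filter_posN[OF C(2)] ne by blast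
      show "{} \<notin> \<Union>\<C>" using filter_nonempty[OF C(2)] by blast
    next
      fix A B assume "A \<in> \<Union>\<C>" "B \<in> \<Union>\<C>"
      then obtain F G where "F \<in> \<C>" "A \<in> F" "G \<in> \<C>" "B \<in> G" by blast
      moreover from this have "A \<in> F \<and> B \<in> F \<or> A \<in> G \<and> B \<in> G" using lin by blast
      ultimately show "A \<inter> B \<in> \<Union>\<C>"
        using filter_Int[OF C(2)] by blast
    next
      fix A B assume "A \<in> \<Union>\<C>" "A \<subseteq> B \<and> B \<subseteq> posN"
      then show "B \<in> \<Union>\<C>" using filter_mono[OF C(2)] by blast
    qed
    moreover have "shift_closed T (\<Union>\<C>)"
      using C(3) unfolding shift_closed_def by blast
    ultimately show "\<Union>\<C> \<in> ?A" using C(1) ne by blast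
  qed
  then obtain F where  F: "F \<in> ?A" "\<forall>X\<in>?A. F \<subseteq> X \<longrightarrow> X = F" by (rule bexE)
  show ?thesis
  proof (rule that)
    fix G assume "proper_filter G" "shift_closed T G" "F \<subseteq> G"
    moreover have "F0 \<subseteq> F" using F(1) by blast
    ultimately show "G = F" using F(2) by blast
  qed (use F(1) in blast)+
qed

lemma filter_extends_to_betaN:
  assumes "proper_filter F0"
  obtains q where "q \<in> betaN" "F0 \<subseteq> q"
proof -
  obtain F where F: "F0 \<subseteq> F" "proper_filter F"
    and max: "\<And>G. proper_filter G \<Longrightarrow> shift_closed {} G \<Longrightarrow> F \<subseteq> G \<Longrightarrow> G = F"
    by (rule maximal_shift_closed_filter[OF assms, of "{}"]) (auto simp: shift_closed_def)
  have "posN - A \<in> F" if A: "A \<subseteq> posN" "A \<notin> F" for A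
  proof -
    \<comment> \<open>\<open>?G\<close> is the filter generated by \<open>F\<close> and
      \<open>A\<close>. Maximality of \<open>F\<close> prevents it from being proper, so some member
      of \<open>F\<close> misses \<open>A\<close>.\<close>
    let ?G = "{B. B \<subseteq> posN \<and> (\<exists>C\<in>F. C \<inter> A \<subseteq> B)}"
    have "A \<in> ?G" using A filter_posN[OF F(2)] by auto
    have FG: "F \<subseteq> ?G" using filter_subset[OF F(2)] by auto
    have "\<not> proper_filter ?G"
      using max[OF _ _ FG] A \<open>A \<in> ?G\<close> by (auto simp: shift_closed_def)
    moreover have "proper_filter ?G" if "{} \<notin> ?G"
      unfolding proper_filter_def
    proof (intro conjI ballI allI impI)
      show "posN \<in> ?G" using filter_posN[OF F(2)] FG by blast
      show "B \<inter> B' \<in> ?G" if BG: "B \<in> ?G" "B' \<in> ?G" for B B'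
      proof -
        obtain C C' where "C \<in> F" "C \<inter> A \<subseteq> B" "C' \<in> F" "C' \<inter> A \<subseteq> B'"
          using BG by blast
        then have "C \<inter> C' \<in> F" "(C \<inter> C') \<inter> A \<subseteq> B \<inter> B'"
          using filter_Int[OF F(2)] by auto
        then show ?thesis using BG by blast
      qed
      show "B' \<in> ?G" if "B \<in> ?G" "B \<subseteq> B' \<and> B' \<subseteq> posN" for B B'
        using that by blast
    qed (use that in auto)
    ultimately obtain C where "C \<in> F" "C \<inter> A = {}" by auto
    then show ?thesis
      using filter_mono[OF F(2), of C "posN - A"] filter_subset[OF F(2), of C] by auto
  qed
  then have "F \<in> betaN" using F by (auto simp: betaN_iff)
  then show ?thesis using that F by blast
qed

text \<open>Such a family is a filter base, so its upward closure is a proper filter and extends to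
  an ultrafilter.\<close>

lemma directed_extends_to_betaN:
  assumes "\<D> \<noteq> {}" "\<And>A. A \<in> \<D> \<Longrightarrow> A \<subseteq> posN" "{} \<notin> \<D>"
    and "\<And>A B. A \<in> \<D> \<Longrightarrow> B \<in> \<D> \<Longrightarrow> \<exists>C\<in>\<D>. C \<subseteq> A \<inter> B"
  obtains q where "q \<in> betaN" "\<D> \<subseteq> q"
proof -
  let ?G = "{B. B \<subseteq> posN \<and> (\<exists>C\<in>\<D>. C \<subseteq> B)}"
  have "proper_filter ?G"
    unfolding proper_filter_def
  proof (intro conjI ballI allI impI)
    show "B \<inter> B' \<in> ?G" if BG: "B \<in> ?G" "B' \<in> ?G" for B B'
    proof -
      obtain C C' where "C \<in> \<D>" "C \<subseteq> B" "C' \<in> \<D>" "C' \<subseteq> B'"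
        using BG by blast
      then obtain D where "D \<in> \<D>" "D \<subseteq> C \<inter> C'" using assms(4)[of C C'] by auto
      moreover from this have "D \<subseteq> B \<inter> B'" using \<open>C \<subseteq> B\<close> \<open>C' \<subseteq> B'\<close> by auto
      ultimately show ?thesis using BG by auto
    qed
    show "posN \<in> ?G" using assms(1,2) by (simp add: ex_in_conv[symmetric])
    show "{} \<notin> ?G" using assms(3) by auto
    show "B' \<in> ?G" if "B \<in> ?G" "B \<subseteq> B' \<and> B' \<subseteq> posN" for B B'
      using that by blast
  qed auto
  then obtain q where q: "q \<in> betaN" "?G \<subseteq> q" by (rule filter_extends_to_betaN)
  have "\<D> \<subseteq> ?G" using assms(2) by auto
  then have "\<D> \<subseteq> q" using q(2) by (rule subset_trans)
  with q(1) show ?thesis by (rule that)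
qed

section \<open>The semigroup and its smallest ideal\<close>

lemma mem_beta_plus:
  "A \<in> beta_plus p q \<longleftrightarrow> A \<subseteq> posN \<and> {x \<in> posN. shift_back x A \<in> q} \<in> p"
  by (simp add: beta_plus_def)

lemma beta_plus_closed:
  assumes p: "p \<in> betaN" and q: "q \<in> betaN"
  shows "beta_plus p q \<in> betaN"
proof -
  note fp = betaN_filter[OF p] and fq = betaN_filter[OF q]
  have "proper_filter (beta_plus p q)"
    unfolding proper_filter_def
  proof (intro conjI ballI allI impI)
    show "beta_plus p q \<subseteq> Pow posN" by (auto simp: beta_plus_def)
    show "posN \<in> beta_plus p q"
      using filter_posN[OF fp] filter_posN[OF fq] by (simp add: mem_beta_plus shift_back_posN)
    show "{} \<notin> beta_plus p q"
    proof -
      have "{} \<notin> p" "{} \<notin> q" using fp fq by (auto simp: proper_filter_def)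
      then show ?thesis by (simp add: mem_beta_plus shift_back_empty)
    qed
  next
    fix A B assume A: "A \<in> beta_plus p q" and B: "B \<in> beta_plus p q"
    have "{x \<in> posN. shift_back x A \<in> q} \<inter> {x \<in> posN. shift_back x B \<in> q} \<in> p"
      using A B filter_Int[OF fp] by (simp add: mem_beta_plus)
    then have "{x \<in> posN. shift_back x (A \<inter> B) \<in> q} \<in> p"
      by (rule filter_mono[OF fp]) (auto simp: shift_back_Int filter_Int[OF fq])
    then show "A \<inter> B \<in> beta_plus p q" using A by (auto simp: mem_beta_plus)
  next
    fix A B assume A: "A \<in> beta_plus p q" and B: "A \<subseteq> B \<and> B \<subseteq> posN"
    have "{x \<in> posN. shift_back x A \<in> q} \<in> p" using A by (simp add: mem_beta_plus)
    moreover have "shift_back x B \<in> q" if "shift_back x A \<in> q" for x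
      using B filter_mono[OF fq that shift_back_mono shift_back_subset] by blast
    ultimately have "{x \<in> posN. shift_back x B \<in> q} \<in> p"
      using filter_mono[OF fp] by (simp add: Collect_mono_iff)
    then show "B \<in> beta_plus p q" using B by (auto simp: mem_beta_plus)
  qed
  moreover have "posN - A \<in> beta_plus p q" if "A \<subseteq> posN" "A \<notin> beta_plus p q" for A
  proof -
    have "{x \<in> posN. shift_back x A \<in> q} \<notin> p" using that by (simp add: mem_beta_plus)
    then have "posN - {x \<in> posN. shift_back x A \<in> q} \<in> p"
      using betaN_Compl_iff[OF p, of "{x \<in> posN. shift_back x A \<in> q}"] by auto
    also have "posN - {x \<in> posN. shift_back x A \<in> q} = {x \<in> posN. shift_back x (posN - A) \<in> q}"
      using betaN_Compl_iff[OF q shift_back_subset] by (auto simp: shift_back_Compl)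
    finally show ?thesis by (simp add: mem_beta_plus)
  qed
  ultimately show ?thesis by (auto simp: betaN_iff)
qed

lemma beta_plus_assoc:
  "beta_plus (beta_plus p q) r = beta_plus p (beta_plus q r)"
proof -
  have "shift_back x {z \<in> posN. shift_back z A \<in> r}
      = {y \<in> posN. shift_back y (shift_back x A) \<in> r}" for x A
    by (auto simp: shift_back_shift_back) (auto simp: shift_back_def posN_def add.commute)
  then show ?thesis
    by (auto simp: beta_plus_def shift_back_subset)
qed

text \<open>Equivalently, betaN + p is a minimal left ideal containing \<open>p\<close>: the point
  can be recovered from every q + p by adding something on the left. This form needs neither ideals
  nor topology.\<close>

definition left_minimal :: "nat set set \<Rightarrow> bool" where
  "left_minimal p \<longleftrightarrow> p \<in> betaN \<and> (\<forall>q\<in>betaN. \<exists>r\<in>betaN. beta_plus r (beta_plus q p) = p)"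

text \<open>The closed left ideals are the sets of ultrafilters extending a shift-invariant filter, so a
  maximal such filter plays the role of a minimal left ideal.\<close>

lemma left_minimal_exists: "\<exists>p. left_minimal p"
proof -
  have "proper_filter {posN}" "shift_closed posN {posN}"
    by (auto simp: proper_filter_def shift_closed_def shift_back_posN) (auto simp: posN_def)
  then obtain F where F: "proper_filter F" "shift_closed posN F"
    and max: "\<And>G. proper_filter G \<Longrightarrow> shift_closed posN G \<Longrightarrow> F \<subseteq> G \<Longrightarrow> G = F"
    by (rule maximal_shift_closed_filter) blast
  obtain p where p: "p \<in> betaN" "F \<subseteq> p" using filter_extends_to_betaN[OF F(1)] .
  note fp = betaN_filter[OF p(1)]
  have "\<exists>r\<in>betaN. beta_plus r (beta_plus q p) = p" if q: "q \<in> betaN" for q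
  proof -
    define s where "s = beta_plus q p"
    have s: "s \<in> betaN" unfolding s_def by (rule beta_plus_closed[OF q p(1)])
    note fs = betaN_filter[OF s]
    \<comment> \<open>The sets all of whose positive translates lie in s = q + p form an invariant
      filter. It contains \<open>F\<close>, so by maximality it is \<open>F\<close>.\<close>
    let ?G = "{A. A \<subseteq> posN \<and> (\<forall>n\<in>posN. shift_back n A \<in> s)}"
    have "proper_filter ?G"
      unfolding proper_filter_def
    proof (intro conjI ballI allI impI)
      show "posN \<in> ?G" using filter_posN[OF fs] by (simp add: shift_back_posN)
      have "1 \<in> posN" by (simp add: posN_def)
      then show "{} \<notin> ?G"
        using filter_nonempty[OF fs, of "{}"] by (auto simp: shift_back_empty)
      show "B \<in> ?G" if A: "A \<in> ?G" and B: "A \<subseteq> B \<and> B \<subseteq> posN" for A B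
      proof -
        have "shift_back n B \<in> s" if "n \<in> posN" for n
          using A B that filter_mono[OF fs _ shift_back_mono shift_back_subset] by blast
        then show ?thesis using B by blast
      qed
    qed (auto simp: shift_back_Int filter_Int[OF fs])
    moreover have "shift_closed posN ?G"
      unfolding shift_closed_def shift_back_shift_back mem_Collect_eq
      using shift_back_subset by (simp add: shift_back_shift_back posN_def)
    moreover have "F \<subseteq> ?G"
    proof
      fix A assume A: "A \<in> F"
      have "{x \<in> posN. shift_back x (shift_back n A) \<in> p} = posN" if "n \<in> posN" for n
        using F(2) A p(2) that by (auto simp: shift_closed_def)
      then have "shift_back n A \<in> s" if "n \<in> posN" for n
        using that filter_posN[OF betaN_filter[OF q]]
        by (simp add: s_def mem_beta_plus shift_back_subset)
      then show "A \<in> ?G" using A filter_subset[OF F(1)] by auto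
    qed
    ultimately have GF: "?G = F" by (rule max)
    \<comment> \<open>Any \<open>r\<close> with r + s = p must contain these sets. None is empty:
      otherwise \<open>posN - A\<close> would lie in \<open>?G\<close>, which equals
      \<open>F\<close>, and hence in \<open>p\<close> together with \<open>A\<close>.\<close>
    let ?D = "(\<lambda>A. {n \<in> posN. shift_back n A \<in> s}) ` p"
    obtain r where r: "r \<in> betaN" "?D \<subseteq> r"
    proof (rule directed_extends_to_betaN[of ?D])
      show "?D \<noteq> {}" using filter_posN[OF fp] by blast
      show "{} \<notin> ?D"
      proof
        assume "{} \<in> ?D"
        then obtain A where A: "A \<in> p" "\<And>n. n \<in> posN \<Longrightarrow> shift_back n A \<notin> s" by auto
        then have "posN - A \<in> ?G"
          using betaN_Compl_iff[OF s shift_back_subset] by (auto simp: shift_back_Compl)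
        then have "posN - A \<in> p" using GF p(2) by blast
        then show False using A(1) betaN_Compl_iff[OF p(1)] filter_subset[OF fp] by blast
      qed
      show "\<exists>C\<in>?D. C \<subseteq> A \<inter> B" if AB: "A \<in> ?D" "B \<in> ?D" for A B
      proof -
        obtain A' B' where *: "A' \<in> p" "A = {n \<in> posN. shift_back n A' \<in> s}"
          "B' \<in> p" "B = {n \<in> posN. shift_back n B' \<in> s}" using AB by blast
        have "shift_back n A' \<in> s" "shift_back n B' \<in> s" if "shift_back n (A' \<inter> B') \<in> s" for n
          using filter_mono[OF fs that shift_back_mono shift_back_subset] by auto
        then have "{n \<in> posN. shift_back n (A' \<inter> B') \<in> s} \<subseteq> A \<inter> B"
          using * by auto
        then show ?thesis using filter_Int[OF fp *(1,3)] by auto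
      qed
    qed auto
    have "p \<subseteq> beta_plus r s"
      using subsetD[OF r(2) imageI] filter_subset[OF fp] by (simp add: mem_beta_plus subset_iff)
    then have "beta_plus r s = p"
      using betaN_eqI[OF p(1) beta_plus_closed[OF r(1) s]] by simp
    then show ?thesis using r(1) by (auto simp: s_def)
  qed
  then show ?thesis using p(1) by (auto simp: left_minimal_def)
qed

text \<open>Left minimal points form an ideal by associativity, and they lie in any ideal
  \<open>I\<close> because p = r + (q + p) can be written with \<open>q\<close> in
  \<open>I\<close>.\<close>

lemma K_betaN_eq: "K_betaN = {p. left_minimal p}"
  unfolding K_betaN_def
proof (rule Least_equality)
  show "two_sided_ideal {p. left_minimal p}"
    unfolding two_sided_ideal_def
  proof (intro conjI ballI)
    show "{p. left_minimal p} \<subseteq> betaN" by (auto simp: left_minimal_def)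
    show "{p. left_minimal p} \<noteq> {}" using left_minimal_exists by blast
  next
    fix s p assume s: "s \<in> betaN" and "p \<in> {p. left_minimal p}"
    then have p: "p \<in> betaN" and min: "\<And>q. q \<in> betaN \<Longrightarrow> \<exists>r\<in>betaN. beta_plus r (beta_plus q p) = p"
      by (auto simp: left_minimal_def)
    \<comment> \<open>If r + ((q + s) + p) = p, then s + r is a witness for s + p. For p + s below,
      the witness belonging to \<open>p\<close> serves unchanged.\<close>
    have "\<exists>r\<in>betaN. beta_plus r (beta_plus q (beta_plus s p)) = beta_plus s p" if "q \<in> betaN" for q
      using min[OF beta_plus_closed[OF that s]] s by (metis beta_plus_assoc beta_plus_closed)
    then show "beta_plus s p \<in> {p. left_minimal p}"
      by (simp add: left_minimal_def beta_plus_closed s p)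
    have "\<exists>r\<in>betaN. beta_plus r (beta_plus q (beta_plus p s)) = beta_plus p s" if "q \<in> betaN" for q
      using min[OF that] by (metis beta_plus_assoc)
    then show "beta_plus p s \<in> {p. left_minimal p}"
      by (simp add: left_minimal_def beta_plus_closed s p)
  qed
next
  fix I assume I: "two_sided_ideal I"
  then obtain q where q: "q \<in> I" "q \<in> betaN" by (auto simp: two_sided_ideal_def)
  show "{p. left_minimal p} \<le> I"
  proof
    fix p assume "p \<in> {p. left_minimal p}"
    then obtain r where "p \<in> betaN" "r \<in> betaN" "beta_plus r (beta_plus q p) = p"
      using q by (auto simp: left_minimal_def)
    then show "p \<in> I" using I q by (metis two_sided_ideal_def)
  qed
qed

section \<open>Sums in members of an idempotent\<close>

text \<open>This is the set usually written A with a star. For idempotent \<open>p\<close> and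
  \<open>A\<close> in \<open>p\<close> it is again in \<open>p\<close>, and so are its translates by
  its own elements; hence a choice made in it never blocks the later ones.\<close>

definition starset :: "nat set set \<Rightarrow> nat set \<Rightarrow> nat set" where
  "starset p A = {x \<in> A. shift_back x A \<in> p}"

lemma mem_shift_back: "y \<in> shift_back x A \<longleftrightarrow> y \<in> posN \<and> x + y \<in> A"
  by (simp add: shift_back_def)

lemma starset_mem:
  assumes "p \<in> betaN" "beta_plus p p = p" "A \<in> p"
  shows "starset p A \<in> p"
proof -
  note fp = betaN_filter[OF assms(1)]
  have "{x \<in> posN. shift_back x A \<in> p} \<in> p" using assms(2,3) by (metis mem_beta_plus)
  then have "A \<inter> {x \<in> posN. shift_back x A \<in> p} \<in> p" by (rule filter_Int[OF fp assms(3)])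
  also have "A \<inter> {x \<in> posN. shift_back x A \<in> p} = starset p A"
    using filter_subset[OF fp assms(3)] by (auto simp: starset_def)
  finally show ?thesis .
qed

text \<open>Forming \<open>starset\<close> commutes with translation, so \<open>starset_mem\<close>
  applies to \<open>shift_back x A\<close>.\<close>

lemma shift_back_starset:
  assumes "p \<in> betaN" "beta_plus p p = p" "A \<in> p" "x \<in> starset p A"
  shows "shift_back x (starset p A) \<in> p"
proof -
  have "shift_back x (starset p A) = starset p (shift_back x A)"
    unfolding set_eq_iff by (simp add: starset_def shift_back_shift_back mem_shift_back add.commute[of _ x])
  then show ?thesis using starset_mem[OF assms(1,2)] assms(4) by (simp add: starset_def)
qed

text \<open>The property \<open>P\<close> is left abstract because the construction serves twice:
  with \<open>C = posN\<close> in the induction on linear forms, where only \<open>FS\<close>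
  matters, and with a translate of the given set in the theorem. The hypothesis on \<open>C\<close>
  says that \<open>C\<close> belongs to 2p + p.\<close>

lemma sums_in_idempotent:
  assumes p: "p \<in> betaN" "beta_plus p p = p" and A: "A \<in> p"
    and C: "{s \<in> posN. shift_back (2 * s) C \<in> p} \<in> p"
    and P: "\<And>n B. B \<in> p \<Longrightarrow> \<exists>Y. finite Y \<and> Y \<subseteq> B \<and> P n Y"
  shows "\<exists>Y. (\<forall>n. P n (Y n)) \<and> FS Y \<subseteq> A \<and> MT21 Y \<subseteq> C"
proof -
  note fp = betaN_filter[OF p(1)]
  define E where "E = A \<inter> {s \<in> posN. shift_back (2 * s) C \<in> p}"
  have E: "E \<in> p" unfolding E_def by (rule filter_Int[OF fp A C])
  \<comment> \<open>In a state (R, S), \<open>R\<close> is the supply for all later choices and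
    \<open>S\<close> collects the sums formed so far.\<close>
  define stable where "stable = (\<lambda>(R, S). R \<in> p \<and> R \<subseteq> E \<and> (\<forall>x\<in>R. shift_back x R \<in> p) \<and> finite (S :: nat set))"
  \<comment> \<open>The new supply keeps sums with the chosen \<open>Y\<close> inside the old one
    and makes every doubled earlier sum compatible with later ones. Intersecting \<open>S'\<close>
    with \<open>E\<close> spares the state from recording that its sums lie in \<open>E\<close>;
    \<open>sumR\<close> provides this afterwards.\<close>
  define ext where "ext = (\<lambda>n (R, S) (R', S'). \<exists>Y. P n Y \<and> Y \<subseteq> R \<and>
     S' = S \<union> Y \<union> (\<lambda>(s, y). s + y) ` (S \<times> Y) \<and> R' \<subseteq> R \<and> (\<forall>y\<in>Y. \<forall>x\<in>R'. y + x \<in> R) \<and>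
     (\<forall>s\<in>S' \<inter> E. \<forall>t\<in>R'. 2 * s + t \<in> C))"
  have "\<exists>f. \<forall>n. stable (f n) \<and> ext n (f n) (f (Suc n))"
  proof (rule dependent_nat_choice)
    show "\<exists>x. stable x"
      using starset_mem[OF p E] shift_back_starset[OF p E]
      by (intro exI[of _ "(starset p E, {})"]) (auto simp: stable_def starset_def)
  next
    fix x n assume "stable x"
    then obtain R S where x: "x = (R, S)" and R: "R \<in> p" "R \<subseteq> E" "\<And>x. x \<in> R \<Longrightarrow> shift_back x R \<in> p"
      and S: "finite S" by (cases x) (auto simp: stable_def)
    obtain Y where Y: "finite Y" "Y \<subseteq> R" "P n Y" using P[OF R(1)] by auto
    define S' where "S' = S \<union> Y \<union> (\<lambda>(s, y). s + y) ` (S \<times> Y)"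
    have S': "finite S'" using S Y(1) by (simp add: S'_def)
    \<comment> \<open>All requirements on the next supply amount to finitely many members of
      \<open>p\<close>; passing to \<open>starset p Q\<close> restores stability.\<close>
    define Q where "Q = R \<inter> (posN \<inter> (\<Inter>y\<in>Y. shift_back y R)) \<inter>
      (posN \<inter> (\<Inter>s\<in>S' \<inter> E. shift_back (2 * s) C))"
    have Q: "Q \<in> p"
      unfolding Q_def
      by (intro filter_Int[OF fp] R(1) filter_INT[OF fp]) (use Y S' R(3) in \<open>auto simp: E_def\<close>)
    have "ext n (R, S) (starset p Q, S')"
      unfolding ext_def prod.case
      by (rule exI[of _ Y]) (use Y in \<open>auto simp: S'_def starset_def Q_def shift_back_def\<close>)
    moreover have "stable (starset p Q, S')"
      using starset_mem[OF p Q] shift_back_starset[OF p Q] S' R(2)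
      by (auto simp: stable_def starset_def Q_def)
    ultimately show "\<exists>y. stable y \<and> ext n x y" using x by blast
  qed
  then obtain f where f: "\<And>n. stable (f n)" "\<And>n. ext n (f n) (f (Suc n))" by auto
  define R S where "R = fst \<circ> f" and "S = snd \<circ> f"
  have fRS: "f n = (R n, S n)" for n by (simp add: R_def S_def)
  have RE: "R n \<subseteq> E" for n using f(1)[of n] by (simp add: fRS stable_def)
  have "\<exists>Y. P n Y \<and> Y \<subseteq> R n \<and>
     S (Suc n) = S n \<union> Y \<union> (\<lambda>(s, y). s + y) ` (S n \<times> Y) \<and> R (Suc n) \<subseteq> R n \<and>
     (\<forall>y\<in>Y. \<forall>x\<in>R (Suc n). y + x \<in> R n) \<and>
     (\<forall>s\<in>S (Suc n) \<inter> E. \<forall>t\<in>R (Suc n). 2 * s + t \<in> C)" for n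
    using f(2)[of n] by (simp add: fRS ext_def)
  then obtain Y where Y: "\<And>n. P n (Y n)" "\<And>n. Y n \<subseteq> R n"
     "\<And>n. S (Suc n) = S n \<union> Y n \<union> (\<lambda>(s, y). s + y) ` (S n \<times> Y n)" "\<And>n. R (Suc n) \<subseteq> R n"
     "\<And>n y x. y \<in> Y n \<Longrightarrow> x \<in> R (Suc n) \<Longrightarrow> y + x \<in> R n"
     "\<And>n s t. s \<in> S (Suc n) \<Longrightarrow> s \<in> E \<Longrightarrow> t \<in> R (Suc n) \<Longrightarrow> 2 * s + t \<in> C"
    by (metis IntI)
  have anti: "R n \<subseteq> R m" if "m \<le> n" for m n
    using lift_Suc_antimono_le[of R, OF Y(4) that] .
  \<comment> \<open>The least index is added last: the other summands add up to an element of
    \<open>R (Suc b)\<close>, and adding an element of \<open>Y b\<close> leads back into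
    \<open>R b\<close>.\<close>
  have sumR: "finite F \<Longrightarrow> \<forall>k. F \<noteq> {} \<and> (\<forall>a\<in>F. k \<le> a \<and> x a \<in> Y a) \<longrightarrow> sum x F \<in> R k" for F x
  proof (induction F rule: finite_linorder_min_induct)
    case empty
    then show ?case by simp
  next
    case (insert b F)
    show ?case
    proof (intro allI impI)
      fix k assume k: "insert b F \<noteq> {} \<and> (\<forall>a\<in>insert b F. k \<le> a \<and> x a \<in> Y a)"
      have "sum x (insert b F) \<in> R b"
      proof (cases "F = {}")
        case True
        then show ?thesis using k Y(2)[of b] by auto
      next
        case False
        then have "sum x F \<in> R (Suc b)" using insert k by (simp add: Suc_le_eq)
        then show ?thesis using Y(5)[of "x b" b] k insert.hyps by auto
      qed
      then show "sum x (insert b F) \<in> R k" using anti k by auto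
    qed
  qed
  \<comment> \<open>Here the largest index is split off instead, following the order in which
    \<open>S\<close> grows.\<close>
  have sumS: "F \<noteq> {} \<longrightarrow> (\<forall>a\<in>F. a < n \<and> x a \<in> Y a) \<longrightarrow> sum x F \<in> S n" for F n x
  proof (induction n arbitrary: F)
    case 0
    then show ?case by auto
  next
    case (Suc n)
    show ?case
    proof (intro impI)
      assume F: "F \<noteq> {}" "\<forall>a\<in>F. a < Suc n \<and> x a \<in> Y a"
      have fin: "finite F" using F by (meson finite_nat_set_iff_bounded)
      show "sum x F \<in> S (Suc n)"
      proof (cases "n \<in> F")
        case False
        then have "\<forall>a\<in>F. a < n \<and> x a \<in> Y a" using F(2) by (metis less_SucE)
        then show ?thesis using Suc F(1) Y(3)[of n] by auto
      next
        case True
        have eq: "sum x F = sum x (F - {n}) + x n" using True fin by (simp add: sum.remove)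
        show ?thesis
        proof (cases "F - {n} = {}")
          case True
          then have "F = {n}" using \<open>n \<in> F\<close> by auto
          then have "sum x F = x n" by simp
          then show ?thesis using F(2) \<open>n \<in> F\<close> Y(3)[of n] by simp
        next
          case False
          moreover have "\<forall>a\<in>F - {n}. a < n \<and> x a \<in> Y a" using F(2) by (metis less_SucE DiffD1 DiffD2 singletonI)
          ultimately have "sum x (F - {n}) \<in> S n" using Suc by auto
          then show ?thesis using eq F \<open>n \<in> F\<close> Y(3)[of n] by auto
        qed
      qed
    qed
  qed
  have "FS Y \<subseteq> A"
  proof
    fix z assume "z \<in> FS Y"
    then obtain F x where F: "finite F" "F \<noteq> {}" "\<forall>n\<in>F. x n \<in> Y n" "z = sum x F"
      by (auto simp: FS_def Pf_def)
    then have "z \<in> R 0" using sumR[of F x] by simp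
    then show "z \<in> A" using RE by (auto simp: E_def)
  qed
  moreover have "MT21 Y \<subseteq> C"
  proof
    fix z assume "z \<in> MT21 Y"
    then obtain F0 F1 x where F: "finite F0" "F0 \<noteq> {}" "finite F1" "F1 \<noteq> {}" "Max F0 < Min F1"
      "\<forall>t \<in> F0 \<union> F1. x t \<in> Y t" "z = 2 * sum x F0 + sum x F1"
      unfolding MT21_def Pf_def set_less_def mem_Collect_eq by metis
    have "sum x F0 \<in> S (Suc (Max F0))" using sumS[of F0 "Suc (Max F0)" x] F by (simp add: less_Suc_eq_le)
    moreover have "sum x F0 \<in> E" using sumR[of F0 x] F RE[of 0] by auto
    moreover have "Suc (Max F0) \<le> a" if "a \<in> F1" for a
      using F(5) Min_le[OF F(3) that] by simp
    then have "sum x F1 \<in> R (Suc (Max F0))"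
      using sumR[of F1 x] F by auto
    ultimately show "z \<in> C" using Y(6) F(7) by auto
  qed
  ultimately show ?thesis using Y(1) by metis
qed

text \<open>Some residue class modulo \<open>c\<close> lies in \<open>p\<close>. Idempotence yields
  x, y and x + y all in this class, so \<open>c\<close> divides \<open>x\<close> and the class is
  that of 0.\<close>

lemma multiples_in_idempotent:
  assumes p: "p \<in> betaN" "beta_plus p p = p" and "0 < c"
  shows "{n \<in> posN. c dvd n} \<in> p"
proof -
  note fp = betaN_filter[OF p(1)]
  let ?B = "\<lambda>r. {n \<in> posN. n mod c = r}"
  have "\<exists>r<c. ?B r \<in> p"
  proof (rule ccontr)
    assume "\<not> ?thesis"
    then have "posN - ?B r \<in> p" if "r < c" for r
      using that betaN_Compl_iff[OF p(1), of "?B r"] by auto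
    then have "posN \<inter> (\<Inter>r\<in>{..<c}. posN - ?B r) \<in> p" by (intro filter_INT[OF fp]) auto
    moreover have "posN \<inter> (\<Inter>r\<in>{..<c}. posN - ?B r) = {}"
      using \<open>0 < c\<close> by auto
    ultimately show False using filter_nonempty[OF fp] by simp
  qed
  then obtain r where r: "?B r \<in> p" by (elim exE conjE)
  have "starset p (?B r) \<noteq> {}" by (rule filter_nonempty[OF fp starset_mem[OF p r]])
  then obtain x where x: "x \<in> ?B r" "shift_back x (?B r) \<in> p"
    by (auto simp: starset_def)
  then have "?B r \<inter> shift_back x (?B r) \<noteq> {}"
    using filter_nonempty[OF fp filter_Int[OF fp r]] by simp
  then obtain y where y: "y mod c = r" "(x + y) mod c = r" by (auto simp: shift_back_def)
  then have "c dvd x" using mod_eq_dvd_iff_nat[of y "x + y" c] by simp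
  then have "r = 0" using x by (simp add: dvd_eq_mod_eq_0)
  then show ?thesis using r by (simp add: dvd_eq_mod_eq_0)
qed

section \<open>An IP van der Waerden theorem for members of minimal ultrafilters\<close>

text \<open>The family models the sets of n with \<open>shift_back n U\<close> in \<open>p\<close>.
  Syndeticity replaces a finite colouring, the elements of \<open>K\<close> being the colours. The
  bound \<open>N\<close> allows the index sets of successive focusing rounds to be kept
  disjoint.\<close>

lemma IP_van_der_Waerden:
  fixes \<S> :: "nat set set" and G :: "(nat \<Rightarrow> nat) set"
  assumes Int: "\<And>U V. U \<in> \<S> \<Longrightarrow> V \<in> \<S> \<Longrightarrow> U \<inter> V \<in> \<S>"
    and shift: "\<And>U m. U \<in> \<S> \<Longrightarrow> {x. x + m \<in> U} \<in> \<S>"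
    and syndetic: "\<And>U. U \<in> \<S> \<Longrightarrow> U \<noteq> {} \<Longrightarrow> \<exists>K. finite K \<and> (\<forall>m. \<exists>t\<in>K. m + t \<in> U)"
    and UNIV: "UNIV \<in> \<S>" and "finite G" "U \<in> \<S>" "U \<noteq> {}"
  shows "\<exists>F. finite F \<and> F \<noteq> {} \<and> (\<forall>n\<in>F. N \<le> n) \<and> (\<exists>x. \<forall>g\<in>G. x + sum g F \<in> U)"
  using assms(5-7)
proof (induction G arbitrary: U N)
  case empty
  then show ?case by (intro exI[of _ "{N}"]) auto
next
  case (insert h G)
  note IH = insert.IH
  obtain K where K: "finite K" "\<And>m. \<exists>t\<in>K. m + t \<in> U" using syndetic insert.prems by metis
  define good where "good F \<longleftrightarrow> finite F \<and> F \<noteq> {} \<and> (\<forall>n\<in>F. N \<le> n)" for F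
  \<comment> \<open>Colour focusing: \<open>t\<close> runs over the colours already focused at the point \<open>x + E\<close>.\<close>
  have focus: "\<exists>F. good F \<and> (\<exists>x. \<forall>g\<in>insert h G. x + sum g F \<in> U)"
    if "V \<in> \<S>" "V \<noteq> {}" "J \<subseteq> K" "N \<le> M"
      "\<And>t. t \<in> J \<Longrightarrow> \<exists>F e. good F \<and> (\<forall>n\<in>F. n < M) \<and> e + sum h F = E \<and>
          (\<forall>x\<in>V. \<forall>g\<in>G. x + sum g F + e + t \<in> U)"
    for V J M E
    using that
  proof (induction "card (K - J)" arbitrary: V J M E rule: less_induct)
    case less
    obtain x0 where x0: "x0 \<in> V" using less.prems(2) by auto
    obtain t where t: "t \<in> K" "x0 + E + t \<in> U" using K(2)[of "x0 + E"] by auto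
    show ?case
    proof (cases "t \<in> J")
      \<comment> \<open>The focal point has a colour already focused there: \<open>h\<close> reaches
        it from x0 + e + t, and the maps in \<open>G\<close> stay in \<open>U\<close> by the
        focusing property.\<close>
      case True
      then obtain F e where F: "good F" "e + sum h F = E" "\<forall>x\<in>V. \<forall>g\<in>G. x + sum g F + e + t \<in> U"
        using less.prems(5) by metis
      have "\<forall>g\<in>insert h G. (x0 + e + t) + sum g F \<in> U"
      proof
        fix g assume "g \<in> insert h G"
        then show "(x0 + e + t) + sum g F \<in> U"
          using t(2) F(3) x0 by (auto simp: F(2)[symmetric] ac_simps)
      qed
      then show ?thesis using F(1) by metis
    next
      case False
      \<comment> \<open>A new colour appears, so \<open>V\<close> is cut down to points whose focal
        point has colour \<open>t\<close>, and the induction hypothesis for \<open>G\<close> is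
        applied beyond \<open>M\<close>.\<close>
      define W where "W = V \<inter> {x. x + (E + t) \<in> U}"
      have "W \<in> \<S>" unfolding W_def by (intro Int shift less.prems(1) insert.prems)
      moreover have "W \<noteq> {}" using x0 t(2) by (auto simp: W_def add.assoc)
      ultimately obtain F y where F: "finite F" "F \<noteq> {}" "\<forall>n\<in>F. M \<le> n" "\<forall>g\<in>G. y + sum g F \<in> W"
        using IH[of W M] by auto
      \<comment> \<open>The focus moves to E + sum h F. Each old pair (D, e) becomes (D \<union> F,
        e), and (F, E) is the pair for the new colour \<open>t\<close>.\<close>
      define V' where "V' = {x. \<forall>g\<in>G. x + sum g F \<in> W}"
      have "{x. \<forall>g\<in>H. x + sum g F \<in> W} \<in> \<S>" if "finite H" for H
        using that
      proof (induction H)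
        case empty
        then show ?case using UNIV by simp
      next
        case (insert g H)
        have "{x. \<forall>g\<in>insert g H. x + sum g F \<in> W} = {x. x + sum g F \<in> W} \<inter> {x. \<forall>g\<in>H. x + sum g F \<in> W}"
          by auto
        then show ?case using Int[OF shift[OF \<open>W \<in> \<S>\<close>, of "sum g F"] insert.IH] by simp
      qed
      then have V': "V' \<in> \<S>" unfolding V'_def using insert.hyps(1) by simp
      have V'ne: "V' \<noteq> {}" using F(4) by (auto simp: V'_def)
      have "card (K - insert t J) < card (K - J)"
        using False t(1) K(1) by (intro psubset_card_mono) auto
      then show ?thesis
      proof (rule less.hyps[of "insert t J" V' "Suc (Max F)" "E + sum h F"])
        show "V' \<in> \<S>" "V' \<noteq> {}" "insert t J \<subseteq> K" using V' V'ne t(1) less.prems(3) by auto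
        have MF: "M \<le> Max F" using F by (meson Max_in)
        then show "N \<le> Suc (Max F)" using less.prems(4) by simp
        have ltF: "n < Suc (Max F)" if "n \<in> F" for n using F(1) that by (simp add: less_Suc_eq_le)
        have FM: "N \<le> n" if "n \<in> F" for n using F(3) that less.prems(4) order_trans by metis
        fix s assume "s \<in> insert t J"
        then show "\<exists>F' e. good F' \<and> (\<forall>n\<in>F'. n < Suc (Max F)) \<and> e + sum h F' = E + sum h F \<and>
          (\<forall>x\<in>V'. \<forall>g\<in>G. x + sum g F' + e + s \<in> U)"
        proof
          assume "s = t"
          then have "good F \<and> (\<forall>n\<in>F. n < Suc (Max F)) \<and> E + sum h F = E + sum h F \<and>
            (\<forall>x\<in>V'. \<forall>g\<in>G. x + sum g F + E + s \<in> U)"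
            using F ltF FM by (auto simp: good_def V'_def W_def add.assoc)
          then show ?thesis by metis
        next
          assume "s \<in> J"
          then obtain D e where D: "good D" "\<forall>n\<in>D. n < M" "e + sum h D = E"
            "\<forall>x\<in>V. \<forall>g\<in>G. x + sum g D + e + s \<in> U"
            using less.prems(5) by metis
          have disj: "D \<inter> F = {}" using D(2) F(3) by (meson disjoint_iff not_le)
          have sumU: "sum g (D \<union> F) = sum g D + sum g F" for g :: "nat \<Rightarrow> nat"
            using D(1) F(1) disj by (intro sum.union_disjoint) (auto simp: good_def)
          have "x + sum g (D \<union> F) + e + s \<in> U" if "x \<in> V'" "g \<in> G" for x g
          proof -
            have "x + sum g F \<in> V" using that by (auto simp: V'_def W_def)
            then have "(x + sum g F) + sum g D + e + s \<in> U" using D(4) that(2) by metis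
            then show ?thesis by (simp add: sumU ac_simps)
          qed
          moreover have "good (D \<union> F)" using D(1) F FM by (auto simp: good_def)
          moreover have "n < Suc (Max F)" if "n \<in> D \<union> F" for n
            using that ltF D(2) MF by (meson Un_iff le_imp_less_Suc less_le_trans less_imp_le)
          moreover have "e + sum h (D \<union> F) = E + sum h F" by (simp add: sumU D(3)[symmetric])
          ultimately show ?thesis by metis
        qed
      qed
    qed
  qed
  have "\<exists>F. good F \<and> (\<exists>x. \<forall>g\<in>insert h G. x + sum g F \<in> U)"
    by (rule focus[of UNIV "{}" N]) (use UNIV in auto)
  then show ?case by (auto simp: good_def)
qed

text \<open>If no finite \<open>K\<close> worked, the sets \<open>?d K\<close> would generate an
  \<open>r\<close> such that no translate of \<open>U\<close> lies in r + p. But p = r' + (r + p)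
  contains \<open>shift_back n U\<close>, which forces such a translate.\<close>

lemma shift_set_syndetic:
  assumes min: "left_minimal p" and n: "shift_back n U \<in> p"
  shows "\<exists>K. finite K \<and> (\<forall>m. \<exists>t\<in>K. shift_back (m + t) U \<in> p)"
proof (rule ccontr)
  assume neg: "\<not> ?thesis"
  have p: "p \<in> betaN" using min by (simp add: left_minimal_def)
  note fp = betaN_filter[OF p]
  let ?d = "\<lambda>K. {m \<in> posN. \<forall>t\<in>K. shift_back (m + t) U \<notin> p}"
  obtain r where r: "r \<in> betaN" "?d ` {K. finite K} \<subseteq> r"
  proof (rule directed_extends_to_betaN[of "?d ` {K. finite K}"])
    show "{} \<notin> ?d ` {K. finite K}"
    proof
      assume "{} \<in> ?d ` {K. finite K}"
      then obtain K where K: "finite K" "\<forall>m\<in>posN. \<exists>t\<in>K. shift_back (m + t) U \<in> p" by auto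
      \<comment> \<open>\<open>K\<close> only handles positive \<open>m\<close>; applying it to
        \<open>Suc m\<close> and moving the 1 into \<open>K\<close> covers 0 as well.\<close>
      have "\<forall>m. \<exists>t\<in>Suc ` K. shift_back (m + t) U \<in> p"
        using K(2) by (auto simp: posN_def) (metis add_Suc zero_less_Suc)
      moreover have "finite (Suc ` K)" using K(1) by simp
      ultimately have "\<exists>K. finite K \<and> (\<forall>m. \<exists>t\<in>K. shift_back (m + t) U \<in> p)"
        by (intro exI[of _ "Suc ` K"] conjI)
      then show False using neg by simp
    qed
    show "\<exists>C\<in>?d ` {K. finite K}. C \<subseteq> A \<inter> B"
      if AB: "A \<in> ?d ` {K. finite K}" "B \<in> ?d ` {K. finite K}" for A B
    proof -
      obtain K K' where "finite K" "A = ?d K" "finite K'" "B = ?d K'" using AB by auto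
      then show ?thesis by (intro bexI[of _ "?d (K \<union> K')"]) auto
    qed
  qed auto
  have notin: "shift_back t U \<notin> beta_plus r p" for t
  proof
    assume "shift_back t U \<in> beta_plus r p"
    then have "{m \<in> posN. shift_back (m + t) U \<in> p} \<in> r"
      by (simp add: mem_beta_plus shift_back_shift_back)
    moreover have "?d {t} \<in> r" by (rule subsetD[OF r(2)], rule imageI) simp
    ultimately have "{m \<in> posN. shift_back (m + t) U \<in> p} \<inter> ?d {t} \<in> r"
      using filter_Int[OF betaN_filter[OF r(1)]] by simp
    moreover have "{m \<in> posN. shift_back (m + t) U \<in> p} \<inter> ?d {t} = {}" by auto
    ultimately show False using filter_nonempty[OF betaN_filter[OF r(1)]] by simp
  qed
  obtain r' where r': "r' \<in> betaN" "beta_plus r' (beta_plus r p) = p"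
    using min r(1) by (auto simp: left_minimal_def)
  have "shift_back n U \<in> beta_plus r' (beta_plus r p)" using n r'(2) by simp
  then have "{m \<in> posN. shift_back (m + n) U \<in> beta_plus r p} \<in> r'"
    by (simp add: mem_beta_plus shift_back_shift_back)
  then show False using notin filter_nonempty[OF betaN_filter[OF r'(1)]] by auto
qed

lemma IP_van_der_Waerden_minimal:
  fixes G :: "(nat \<Rightarrow> nat) set"
  assumes min: "left_minimal p" and A: "A \<in> p" and G: "finite G"
  obtains F b where "finite F" "F \<noteq> {}" "b \<in> posN" "\<And>g. g \<in> G \<Longrightarrow> b + sum g F \<in> A"
proof -
  have p: "p \<in> betaN" using min by (simp add: left_minimal_def)
  note fp = betaN_filter[OF p]
  let ?T = "\<lambda>U. {n. shift_back n U \<in> p}"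
  have AN: "A \<subseteq> posN" using filter_subset[OF fp A] .
  have "\<exists>F. finite F \<and> F \<noteq> {} \<and> (\<forall>n\<in>F. 0 \<le> n) \<and> (\<exists>x. \<forall>g\<in>G. x + sum g F \<in> ?T A)"
  proof (rule IP_van_der_Waerden[of "?T ` Pow posN"])
    fix U V assume "U \<in> ?T ` Pow posN" "V \<in> ?T ` Pow posN"
    then obtain U' V' where "U = ?T U'" "U' \<subseteq> posN" "V = ?T V'" "V' \<subseteq> posN" by auto
    moreover have "?T (U' \<inter> V') = ?T U' \<inter> ?T V'"
    proof -
      have "shift_back n U' \<inter> shift_back n V' \<in> p \<longleftrightarrow> shift_back n U' \<in> p \<and> shift_back n V' \<in> p" for n
        using filter_Int[OF fp] filter_mono[OF fp _ Int_lower1 shift_back_subset]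
          filter_mono[OF fp _ Int_lower2 shift_back_subset] by metis
      then show ?thesis by (auto simp: shift_back_Int)
    qed
    ultimately show "U \<inter> V \<in> ?T ` Pow posN" by (intro image_eqI[of _ _ "U' \<inter> V'"]) auto
  next
    fix U m assume "U \<in> ?T ` Pow posN"
    then obtain U' where "U = ?T U'" by auto
    then show "{x. x + m \<in> U} \<in> ?T ` Pow posN"
      by (intro image_eqI[of _ _ "shift_back m U'"]) (simp_all add: shift_back_shift_back shift_back_subset)
  next
    fix U assume "U \<in> ?T ` Pow posN" "U \<noteq> {}"
    then show "\<exists>K. finite K \<and> (\<forall>m. \<exists>t\<in>K. m + t \<in> U)"
      using shift_set_syndetic[OF min] by auto
  next
    show "UNIV \<in> ?T ` Pow posN"
      using filter_posN[OF fp] by (intro image_eqI[of _ _ posN]) (auto simp: shift_back_posN)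
    show "?T A \<noteq> {}" using A by (auto simp: shift_back_0[OF AN] intro!: exI[of _ 0])
    show "?T A \<in> ?T ` Pow posN" using AN by auto
  qed (rule G)
  then obtain F x where F: "finite F" "F \<noteq> {}" "\<And>g. g \<in> G \<Longrightarrow> shift_back (x + sum g F) A \<in> p" by auto
  have "posN \<inter> (\<Inter>g\<in>G. shift_back (x + sum g F) A) \<in> p"
    by (rule filter_INT[OF fp G]) (rule F(3))
  \<comment> \<open>The focusing argument gives only translates of \<open>A\<close> lying in
    \<open>p\<close>; a common point \<open>y\<close> of these finitely many translates turns them
    into elements of \<open>A\<close>.\<close>
  then have "posN \<inter> (\<Inter>g\<in>G. shift_back (x + sum g F) A) \<noteq> {}" by (rule filter_nonempty[OF fp])
  then obtain y where y: "y \<in> posN" "\<And>g. g \<in> G \<Longrightarrow> x + sum g F + y \<in> A"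
    unfolding ex_in_conv[symmetric] by (simp add: mem_shift_back) metis
  show ?thesis
  proof (rule that[OF F(1,2), of "x + y"])
    show "x + y \<in> posN" using y(1) by (simp add: posN_def)
    show "x + y + sum g F \<in> A" if "g \<in> G" for g using y(2)[OF that] by (simp add: ac_simps)
  qed
qed

section \<open>Rational points near a real limit direction\<close>

lemma common_denominator:
  fixes q :: "'a \<Rightarrow> rat"
  assumes "finite J"
  obtains d z where "0 < d" "\<And>j. j \<in> J \<Longrightarrow> of_int d * q j = of_int (z j)"
proof -
  have "\<exists>d z. 0 < d \<and> (\<forall>j\<in>J. of_int d * q j = of_int (z j))"
    using assms
  proof (induction J)
    case empty
    then show ?case by (auto intro!: exI[of _ 1])
  next
    case (insert k J)
    then obtain d z where d: "0 < d" "\<forall>j\<in>J. of_int d * q j = of_int (z j)" by auto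
    obtain a b where ab: "quotient_of (q k) = (a, b)" by (cases "quotient_of (q k)")
    have b: "0 < b" using quotient_of_denom_pos[OF ab] .
    have "q k = of_int a / of_int b" by (rule quotient_of_div[OF ab])
    then have "of_int (d * b) * q k = of_int (d * a)" using b by simp
    moreover have "of_int (d * b) * q j = of_int (b * z j)" if "j \<in> J" for j
      using d(2) that by (simp add: algebra_simps)
    ultimately have "\<forall>j\<in>insert k J. of_int (d * b) * q j = of_int (if j = k then d * a else b * z j)"
      by auto
    moreover have "0 < d * b" using d b by simp
    ultimately show ?case by (intro exI[of _ "d * b"] exI[of _ "\<lambda>j. if j = k then d * a else b * z j"] conjI)
  qed
  then show ?thesis using that by auto
qed

lemma sum_unit:
  fixes u :: "'i \<Rightarrow> 'a :: comm_ring_1"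
  assumes "finite I" "i \<in> I"
  shows "(\<Sum>j\<in>I. of_bool (j = i) * u j) = u i"
  using assms by (simp add: of_bool_def if_distrib[of "\<lambda>t. t * _"] cong: if_cong)

lemma of_rat_of_bool: "of_rat (of_bool P) = (of_bool P :: real)"
  by (cases P) simp_all

text \<open>If the coordinates are linearly independent over the rationals, any close rational point
  will do. Otherwise one coordinate is a rational combination of the others; it is removed and then
  recomputed from the approximations of the others.\<close>

lemma rational_approximation:
  fixes \<phi> :: "'i \<Rightarrow> real"
  assumes "finite I" "0 < \<epsilon>"
  shows "\<exists>\<psi> :: 'i \<Rightarrow> rat. (\<forall>i\<in>I. \<bar>of_rat (\<psi> i) - \<phi> i\<bar> < \<epsilon>) \<and>
    (\<forall>a. (\<Sum>i\<in>I. of_rat (a i) * \<phi> i) = 0 \<longrightarrow> (\<Sum>i\<in>I. a i * \<psi> i) = 0)"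
  using assms
proof (induction I arbitrary: \<epsilon> rule: finite_psubset_induct)
  case (psubset I)
  show ?case
  proof (cases "\<exists>a. \<exists>k\<in>I. a k \<noteq> 0 \<and> (\<Sum>i\<in>I. of_rat (a i) * \<phi> i) = 0")
    case False
    have "\<exists>r. \<bar>of_rat r - \<phi> i\<bar> < \<epsilon>" for i
    proof -
      obtain r where "\<phi> i - \<epsilon> < of_rat r" "of_rat r < \<phi> i + \<epsilon>"
        using of_rat_dense[of "\<phi> i - \<epsilon>" "\<phi> i + \<epsilon>"] psubset.prems by auto
      then show ?thesis by (intro exI[of _ r]) (simp add: abs_less_iff)
    qed
    then obtain \<psi> where "\<And>i. \<bar>of_rat (\<psi> i) - \<phi> i\<bar> < \<epsilon>" by metis
    moreover have "(\<Sum>i\<in>I. a i * \<psi> i) = 0" if "(\<Sum>i\<in>I. of_rat (a i) * \<phi> i) = 0" for a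
      using False that by (intro sum.neutral) auto
    ultimately show ?thesis by auto
  next
    case True
    then obtain a k where k: "k \<in> I" "a k \<noteq> 0" "(\<Sum>i\<in>I. of_rat (a i) * \<phi> i) = 0" by auto
    define J where "J = I - {k}"
    have I: "I = insert k J" "k \<notin> J" "finite J" using k psubset.hyps by (auto simp: J_def)
    define q where "q i = - a i / a k" for i
    have \<phi>k: "\<phi> k = (\<Sum>i\<in>J. of_rat (q i) * \<phi> i)"
    proof -
      have "of_rat (a k) * \<phi> k = - (\<Sum>i\<in>J. of_rat (a i) * \<phi> i)" using k(3) I by simp
      then have "\<phi> k = - (\<Sum>i\<in>J. of_rat (a i) * \<phi> i) / of_rat (a k)"
        using k(2) by (simp add: field_simps)
      also have "\<dots> = (\<Sum>i\<in>J. of_rat (q i) * \<phi> i)"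
        by (simp add: q_def of_rat_divide of_rat_minus sum_divide_distrib sum_negf[symmetric])
      finally show ?thesis .
    qed
    define c :: real where "c = (\<Sum>i\<in>J. \<bar>of_rat (q i)\<bar>)"
    have c: "0 \<le> c" by (simp add: c_def sum_nonneg)
    \<comment> \<open>The error in coordinate \<open>k\<close> is at most \<open>c\<close> times
      that of the others; 1 + c instead of \<open>c\<close> gives a strict bound and covers c =
      0.\<close>
    have "0 < \<epsilon> / (1 + c)" using c psubset.prems by simp
    moreover have "J \<subset> I" using I by auto
    ultimately obtain \<psi> where \<psi>: "\<And>i. i \<in> J \<Longrightarrow> \<bar>of_rat (\<psi> i) - \<phi> i\<bar> < \<epsilon> / (1 + c)"
      "\<And>b. (\<Sum>i\<in>J. of_rat (b i) * \<phi> i) = 0 \<Longrightarrow> (\<Sum>i\<in>J. b i * \<psi> i) = 0"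
      using psubset.IH by metis
    define \<chi> where "\<chi> = \<psi>(k := (\<Sum>i\<in>J. q i * \<psi> i))"
    have \<chi>J: "\<chi> i = \<psi> i" if "i \<in> J" for i using that I(2) by (auto simp: \<chi>_def)
    have le: "\<epsilon> / (1 + c) \<le> \<epsilon>" using c psubset.prems by (simp add: field_simps)
    have "\<bar>of_rat (\<chi> k) - \<phi> k\<bar> = \<bar>\<Sum>i\<in>J. of_rat (q i) * (of_rat (\<psi> i) - \<phi> i)\<bar>"
      by (simp add: \<chi>_def \<phi>k of_rat_sum of_rat_mult sum_subtractf right_diff_distrib)
    also have "\<dots> \<le> (\<Sum>i\<in>J. \<bar>of_rat (q i)\<bar> * (\<epsilon> / (1 + c)))"
    proof (rule order_trans[OF sum_abs sum_mono])
      fix i assume "i \<in> J"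
      then show "\<bar>of_rat (q i) * (of_rat (\<psi> i) - \<phi> i)\<bar> \<le> \<bar>of_rat (q i)\<bar> * (\<epsilon> / (1 + c))"
        unfolding abs_mult using \<psi>(1) by (intro mult_left_mono) (auto intro: less_imp_le)
    qed
    also have "\<dots> = c * (\<epsilon> / (1 + c))" by (simp only: c_def sum_distrib_right)
    also have "\<dots> < \<epsilon>" using c psubset.prems by (simp add: field_simps)
    finally have "\<bar>of_rat (\<chi> k) - \<phi> k\<bar> < \<epsilon>" .
    then have "\<bar>of_rat (\<chi> i) - \<phi> i\<bar> < \<epsilon>" if "i \<in> I" for i
      using that I(1) \<psi>(1)[of i] \<chi>J[of i] le by auto
    moreover have "(\<Sum>i\<in>I. b i * \<chi> i) = 0" if "(\<Sum>i\<in>I. of_rat (b i) * \<phi> i) = 0" for b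
    proof -
      have "(\<Sum>i\<in>J. of_rat (b i + b k * q i) * \<phi> i) = 0"
        using that I by (simp add: \<phi>k of_rat_add of_rat_mult sum.distrib sum_distrib_left algebra_simps)
      then have "(\<Sum>i\<in>J. (b i + b k * q i) * \<psi> i) = 0" by (rule \<psi>(2))
      moreover have "(\<Sum>i\<in>J. b i * \<chi> i) = (\<Sum>i\<in>J. b i * \<psi> i)" using \<chi>J by simp
      ultimately show ?thesis using I
        by (simp add: \<chi>_def sum.distrib sum_distrib_left algebra_simps)
    qed
    ultimately show ?thesis by (intro exI[of _ \<chi>]) auto
  qed
qed

section \<open>Solvability of linear systems over a field\<close>

lemma functional_in_span:
  fixes m :: "'i \<Rightarrow> nat \<Rightarrow> 'a :: field"
  assumes "finite I"
    and "\<And>z. (\<forall>i\<in>I. (\<Sum>j<v. m i j * z j) = 0) \<Longrightarrow> (\<Sum>j<v. g j * z j) = 0"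
  shows "\<exists>b. \<forall>j<v. g j = (\<Sum>i\<in>I. b i * m i j)"
  using assms
proof (induction I arbitrary: g)
  case empty
  have "g j = 0" if "j < v" for j
    using empty.prems[of "\<lambda>l. if l = j then 1 else 0"] that by (simp add: if_distrib sum.delta cong: if_cong)
  then show ?case by simp
next
  case (insert k I)
  let ?f = "\<lambda>i z. \<Sum>j<v. m i j * z j"
  show ?case
  proof (cases "\<forall>z. (\<forall>i\<in>I. ?f i z = 0) \<longrightarrow> ?f k z = 0")
    case True
    then obtain b where "\<forall>j<v. g j = (\<Sum>i\<in>I. b i * m i j)"
      using insert.IH[of g] insert.prems by auto
    then have "\<forall>j<v. g j = (\<Sum>i\<in>insert k I. (b(k := 0)) i * m i j)"
      using insert.hyps by (auto intro!: sum.cong)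
    then show ?thesis by metis
  next
    case False
    then obtain z0 where z0: "\<forall>i\<in>I. ?f i z0 = 0" "?f k z0 \<noteq> 0" by auto
    define c where "c = (\<Sum>j<v. g j * z0 j) / ?f k z0"
    have lin: "(\<Sum>j<v. u j * (z j - t * z0 j)) = (\<Sum>j<v. u j * z j) - t * (\<Sum>j<v. u j * z0 j)"
      for u z t by (simp add: algebra_simps sum_subtractf sum_distrib_left)
    have "(\<Sum>j<v. (g j - c * m k j) * z j) = 0" if z: "\<forall>i\<in>I. ?f i z = 0" for z
    proof -
      let ?t = "?f k z / ?f k z0"
      have "\<forall>i\<in>insert k I. ?f i (\<lambda>j. z j - ?t * z0 j) = 0"
        using z z0 unfolding lin by auto
      then have "(\<Sum>j<v. g j * (z j - ?t * z0 j)) = 0" by (rule insert.prems)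
      then have "(\<Sum>j<v. g j * z j) = c * ?f k z"
        unfolding lin by (simp add: c_def mult.commute)
      then show ?thesis by (simp add: algebra_simps sum_subtractf sum_distrib_left)
    qed
    then obtain b where b: "\<forall>j<v. g j - c * m k j = (\<Sum>i\<in>I. b i * m i j)"
      using insert.IH[of "\<lambda>j. g j - c * m k j"] by auto
    have "g j = (\<Sum>i\<in>insert k I. (b(k := c)) i * m i j)" if "j < v" for j
    proof -
      have "(\<Sum>i\<in>I. (b(k := c)) i * m i j) = (\<Sum>i\<in>I. b i * m i j)"
        using insert.hyps by (intro sum.cong) auto
      then show ?thesis using b that insert.hyps by (simp add: algebra_simps)
    qed
    then show ?thesis by metis
  qed
qed

text \<open>The system is homogenised by an extra coordinate \<open>v\<close>. If it has no
  solution, every homogeneous solution has \<open>z v = 0\<close>, so this coordinate is a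
  combination of the extended rows; the coefficients then violate \<open>rel\<close>.\<close>

lemma Fredholm_alternative:
  fixes m :: "'i \<Rightarrow> nat \<Rightarrow> 'a :: field"
  assumes "finite I"
    and rel: "\<And>a. (\<forall>j<v. (\<Sum>i\<in>I. a i * m i j) = 0) \<Longrightarrow> (\<Sum>i\<in>I. a i * \<psi> i) = 0"
  shows "\<exists>w. \<forall>i\<in>I. (\<Sum>j<v. m i j * w j) = \<psi> i"
proof (rule ccontr)
  assume neg: "\<not> ?thesis"
  let ?m = "\<lambda>i j. if j = v then - \<psi> i else m i j"
  let ?g = "\<lambda>j. if j = v then 1 else 0"
  have "\<exists>b. \<forall>j<Suc v. ?g j = (\<Sum>i\<in>I. b i * ?m i j)"
  proof (rule functional_in_span[OF \<open>finite I\<close>])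
    fix z assume z: "\<forall>i\<in>I. (\<Sum>j<Suc v. ?m i j * z j) = 0"
    have eq: "(\<Sum>j<v. m i j * z j) = \<psi> i * z v" if "i \<in> I" for i
    proof -
      have "(\<Sum>j<v. ?m i j * z j) = (\<Sum>j<v. m i j * z j)" by (intro sum.cong) auto
      then show ?thesis using z that by simp
    qed
    have "z v = 0"
    proof (rule ccontr)
      assume "z v \<noteq> 0"
      then have "\<forall>i\<in>I. (\<Sum>j<v. m i j * (z j / z v)) = \<psi> i"
        using eq by (simp add: sum_divide_distrib[symmetric])
      then show False using neg by metis
    qed
    then show "(\<Sum>j<Suc v. ?g j * z j) = 0" by (auto intro!: sum.neutral)
  qed
  then obtain b where b: "\<And>j. j < Suc v \<Longrightarrow> ?g j = (\<Sum>i\<in>I. b i * ?m i j)" by auto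
  have "(\<Sum>i\<in>I. b i * m i j) = 0" if "j < v" for j using b[of j] that by simp
  then have "(\<Sum>i\<in>I. b i * \<psi> i) = 0" using rel by simp
  then show False using b[of v] by (simp add: sum_negf)
qed

section \<open>Compactness and the limit direction\<close>

lemma convergent_subsequence_family:
  fixes \<phi> :: "nat \<Rightarrow> 'i \<Rightarrow> real"
  assumes "finite I" "\<And>n i. i \<in> I \<Longrightarrow> \<bar>\<phi> n i\<bar> \<le> 1"
  shows "\<exists>r L. strict_mono r \<and> (\<forall>i\<in>I. (\<lambda>n. \<phi> (r n) i) \<longlonglongrightarrow> L i)"
  using assms
proof (induction I)
  case empty
  then show ?case using strict_mono_id by auto
next
  case (insert k I)
  then obtain r L where r: "strict_mono r" "\<forall>i\<in>I. (\<lambda>n. \<phi> (r n) i) \<longlonglongrightarrow> L i" by auto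
  obtain s where s: "strict_mono s" "monoseq (\<lambda>n. \<phi> (r (s n)) k)"
    using seq_monosub[of "\<lambda>n. \<phi> (r n) k"] by auto
  have "Bseq (\<lambda>n. \<phi> (r (s n)) k)" by (rule BseqI'[of _ 1]) (simp add: insert.prems)
  then obtain l where l: "(\<lambda>n. \<phi> (r (s n)) k) \<longlonglongrightarrow> l"
    using Bseq_monoseq_convergent[OF _ s(2)] by (auto simp: convergent_def)
  have "(\<lambda>n. \<phi> (r (s n)) i) \<longlonglongrightarrow> L i" if "i \<in> I" for i
    using LIMSEQ_subseq_LIMSEQ[OF r(2)[rule_format, OF that] s(1)] by (simp add: o_def)
  then have "\<forall>i\<in>insert k I. (\<lambda>n. \<phi> ((r \<circ> s) n) i) \<longlonglongrightarrow> (L(k := l)) i"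
    using l insert.hyps by auto
  then show ?case using strict_mono_o[OF r(1) s(1)] by metis
qed

definition lin_form :: "nat \<Rightarrow> (nat \<Rightarrow> int) \<Rightarrow> (nat \<Rightarrow> int) \<Rightarrow> int" where
  "lin_form v m z = (\<Sum>j<v. m j * z j)"

text \<open>\<open>R\<close> marks the forms whose values must land in a prescribed set; the others
  only have to be positive. The limit of the normalised values may be irrational, so it is replaced
  by a nearby rational point obeying the same rational relations, which therefore comes from a
  vector \<open>w\<close>.\<close>

lemma limit_direction:
  fixes m :: "'i \<Rightarrow> nat \<Rightarrow> int" and x :: "nat \<Rightarrow> nat \<Rightarrow> int" and v :: nat
  defines "f \<equiv> \<lambda>i. lin_form v (m i)"
  assumes I: "finite I" "I \<noteq> {}"
    and pos: "\<And>n i. i \<in> I \<Longrightarrow> 0 < f i (x n)"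
    and dich: "\<And>n i k. i \<in> I \<inter> R \<Longrightarrow> k \<in> I \<inter> R \<Longrightarrow>
      \<bar>ln (real_of_int (f i (x n))) - ln (real_of_int (f k (x n)))\<bar> < 1 / real (n + 1) \<or>
      \<bar>ln (real_of_int (f i (x n))) - ln (real_of_int (f k (x n)))\<bar> > real n"
  shows "\<exists>w. (\<forall>i\<in>I. 0 \<le> f i w) \<and> (\<exists>i\<in>I. 0 < f i w) \<and>
    (\<forall>i\<in>I \<inter> R. \<forall>k\<in>I \<inter> R. 0 < f i w \<longrightarrow> 0 < f k w \<longrightarrow> f i w = f k w)"
proof -
  \<comment> \<open>Dividing by the sum makes the values add up to 1, so the limit is not
    identically zero.\<close>
  define s where "s n = (\<Sum>i\<in>I. real_of_int (f i (x n)))" for n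
  have s: "0 < s n" for n unfolding s_def using I pos by (intro sum_pos) auto
  define \<phi> where "\<phi> n i = real_of_int (f i (x n)) / s n" for n i
  have \<phi>pos: "0 < \<phi> n i" if "i \<in> I" for n i using pos s that by (simp add: \<phi>_def)
  have "real_of_int (f i (x n)) \<le> s n" if "i \<in> I" for n i
    unfolding s_def using I(1) that pos by (intro member_le_sum) (auto intro: less_imp_le)
  then have "\<bar>\<phi> n i\<bar> \<le> 1" if "i \<in> I" for n i
    using s[of n] pos[OF that, of n] that by (simp add: \<phi>_def abs_of_pos)
  then obtain r L where r: "strict_mono r" "\<And>i. i \<in> I \<Longrightarrow> (\<lambda>n. \<phi> (r n) i) \<longlonglongrightarrow> L i"
    using convergent_subsequence_family[OF I(1), of \<phi>] by metis
  have L0: "0 \<le> L i" if "i \<in> I" for i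
    using \<phi>pos[OF that] by (intro LIMSEQ_le_const[OF r(2)[OF that]]) (auto intro: less_imp_le)
  have "(\<lambda>n. \<Sum>i\<in>I. \<phi> (r n) i) \<longlonglongrightarrow> (\<Sum>i\<in>I. L i)" by (intro tendsto_sum r(2))
  moreover have "(\<Sum>i\<in>I. \<phi> (r n) i) = 1" for n
    using s[of "r n"] by (simp add: \<phi>_def s_def sum_divide_distrib[symmetric])
  ultimately have sumL: "(\<Sum>i\<in>I. L i) = 1" using LIMSEQ_unique[OF _ tendsto_const] by fastforce
  \<comment> \<open>Distinct positive limits would make the logarithmic distances converge to some c
    > 0, which eventually excludes both being below 1/(n + 1) and exceeding n.\<close>
  have Leq: "L i = L k" if ik: "i \<in> I \<inter> R" "k \<in> I \<inter> R" "0 < L i" "0 < L k" for i k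
  proof (rule ccontr)
    assume "L i \<noteq> L k"
    define D where "D n = \<bar>ln (\<phi> (r n) i) - ln (\<phi> (r n) k)\<bar>" for n
    define c where "c = \<bar>ln (L i) - ln (L k)\<bar>"
    have c: "0 < c" using \<open>L i \<noteq> L k\<close> ik by (simp add: c_def)
    have Dc: "D \<longlonglongrightarrow> c"
      unfolding D_def c_def using ik by (intro tendsto_intros r(2)) auto
    have "eventually (\<lambda>n. c / 2 < D n) sequentially" "eventually (\<lambda>n. D n < c + 1) sequentially"
      by (rule order_tendstoD[OF Dc], use c in simp)+
    moreover have "eventually (\<lambda>n. c + 1 < real n) sequentially"
      using filterlim_real_sequentially by (simp add: filterlim_at_top_dense)
    moreover have "eventually (\<lambda>n. 1 / real (Suc n) < c / 2) sequentially"
      using order_tendstoD(2)[OF lim_inverse_n'[THEN LIMSEQ_Suc], of "c / 2"] c by simp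
    ultimately have "eventually (\<lambda>n. c / 2 < D n \<and> D n < c + 1 \<and> c + 1 < real n \<and> 1 / real (Suc n) < c / 2) sequentially"
      by eventually_elim simp
    then obtain n where n: "c / 2 < D n" "D n < c + 1" "c + 1 < real n" "1 / real (Suc n) < c / 2"
      by (auto simp: eventually_sequentially)
    have rn: "n \<le> r n" using r(1) by (rule seq_suble)
    have "D n = \<bar>ln (real_of_int (f i (x (r n)))) - ln (real_of_int (f k (x (r n))))\<bar>"
      using ik pos[of i "r n"] pos[of k "r n"] s[of "r n"] by (simp add: D_def \<phi>_def ln_div)
    then consider "D n < 1 / (real (r n) + 1)" | "D n > real (r n)" using dich[OF ik(1,2), of "r n"] by (auto simp: add.commute)
    then show False
    proof cases
      case 1
      also have "1 / (real (r n) + 1) \<le> 1 / real (Suc n)" using rn by (simp add: field_simps)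
      finally show False using n by simp
    next
      case 2
      then show False using n rn by simp
    qed
  qed
  \<comment> \<open>An error below the smallest positive limit preserves positivity; the inserted 1
    keeps the set nonempty.\<close>
  define \<epsilon> where "\<epsilon> = Min (insert 1 (L ` {i \<in> I. 0 < L i}))"
  have \<epsilon>: "0 < \<epsilon>" "\<And>i. i \<in> I \<Longrightarrow> 0 < L i \<Longrightarrow> \<epsilon> \<le> L i"
    using I(1) by (auto simp: \<epsilon>_def)
  obtain \<psi> where \<psi>: "\<And>i. i \<in> I \<Longrightarrow> \<bar>of_rat (\<psi> i) - L i\<bar> < \<epsilon>"
    "\<And>a. (\<Sum>i\<in>I. of_rat (a i) * L i) = 0 \<Longrightarrow> (\<Sum>i\<in>I. a i * \<psi> i) = 0"
    using rational_approximation[OF I(1) \<epsilon>(1), of L] by auto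
  have \<psi>pos: "0 < \<psi> i" if "i \<in> I" "0 < L i" for i
  proof -
    have "0 < (of_rat (\<psi> i) :: real)" using \<psi>(1)[OF that(1)] \<epsilon>(2)[OF that] by linarith
    then show ?thesis by simp
  qed
  \<comment> \<open>Vanishing of a limit and equality of two limits are rational linear relations,
    so \<psi> inherits both.\<close>
  have \<psi>0: "\<psi> i = 0" if "i \<in> I" "L i = 0" for i
    using \<psi>(2)[of "\<lambda>j. of_bool (j = i)"] that I(1)
    by (simp add: of_rat_of_bool sum_unit)
  have \<psi>eq: "\<psi> i = \<psi> k" if "i \<in> I" "k \<in> I" "L i = L k" for i k
  proof -
    let ?a = "\<lambda>j. of_bool (j = i) - (of_bool (j = k) :: rat)"
    have "(\<Sum>j\<in>I. ?a j * u j) = u i - u k" for u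
      using that I(1) by (simp add: left_diff_distrib sum_subtractf sum_unit)
    moreover have "(\<Sum>j\<in>I. of_rat (?a j) * u j) = u i - u k" for u :: "_ \<Rightarrow> real"
      using that I(1) by (simp add: of_rat_diff left_diff_distrib sum_subtractf of_rat_of_bool sum_unit)
    ultimately show ?thesis using \<psi>(2)[of ?a] that(3) by simp
  qed
  \<comment> \<open>A relation among the rows of \<open>m\<close> holds for all normalised values,
    hence for \<open>L\<close> and hence for \<psi>.\<close>
  have "\<exists>w. \<forall>i\<in>I. (\<Sum>j<v. of_int (m i j) * w j) = \<psi> i"
  proof (rule Fredholm_alternative[OF I(1)])
    fix a :: "'i \<Rightarrow> rat" assume a: "\<forall>j<v. (\<Sum>i\<in>I. a i * of_int (m i j)) = 0"
    have "(\<Sum>i\<in>I. a i * of_int (f i z)) = 0" for z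
    proof -
      have "(\<Sum>i\<in>I. a i * of_int (f i z)) = (\<Sum>i\<in>I. \<Sum>j<v. a i * of_int (m i j) * of_int (z j))"
        by (simp add: f_def lin_form_def sum_distrib_left mult.assoc)
      also have "\<dots> = (\<Sum>j<v. \<Sum>i\<in>I. a i * of_int (m i j) * of_int (z j))" by (rule sum.swap)
      also have "\<dots> = (\<Sum>j<v. (\<Sum>i\<in>I. a i * of_int (m i j)) * of_int (z j))"
        by (simp add: sum_distrib_right)
      finally show ?thesis using a by simp
    qed
    then have "of_rat (\<Sum>i\<in>I. a i * of_int (f i (x n))) = (0 :: real)" for n by simp
    then have "(\<Sum>i\<in>I. of_rat (a i) * real_of_int (f i (x n))) = 0" for n
      by (simp add: of_rat_sum of_rat_mult)
    then have "(\<Sum>i\<in>I. of_rat (a i) * \<phi> (r n) i) = 0" for n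
      by (simp add: \<phi>_def sum_divide_distrib[symmetric])
    moreover have "(\<lambda>n. \<Sum>i\<in>I. of_rat (a i) * \<phi> (r n) i) \<longlonglongrightarrow> (\<Sum>i\<in>I. of_rat (a i) * L i)"
      by (intro tendsto_intros r(2))
    ultimately have "(\<Sum>i\<in>I. of_rat (a i) * L i) = 0"
      using LIMSEQ_unique[OF _ tendsto_const] by fastforce
    then show "(\<Sum>i\<in>I. a i * \<psi> i) = 0" by (rule \<psi>(2))
  qed
  then obtain w where w: "\<And>i. i \<in> I \<Longrightarrow> (\<Sum>j<v. of_int (m i j) * w j) = \<psi> i" by auto
  obtain d z where d: "0 < d" "\<And>j. j \<in> {..<v} \<Longrightarrow> of_int d * w j = of_int (z j)"
    by (rule common_denominator[of "{..<v}" w]) auto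
  have fz: "of_int (f i z) = of_int d * \<psi> i" if "i \<in> I" for i
  proof -
    have "of_int (f i z) = (\<Sum>j<v. of_int (m i j) * (of_int d * w j))"
      using d(2) by (simp add: f_def lin_form_def)
    also have "\<dots> = of_int d * \<psi> i"
      by (simp add: w[OF that, symmetric] sum_distrib_left algebra_simps)
    finally show ?thesis .
  qed
  have \<psi>Lpos: "0 < \<psi> i \<longleftrightarrow> 0 < L i" if "i \<in> I" for i
    using \<psi>pos[OF that] \<psi>0[OF that] L0[OF that] by (cases "L i = 0") auto
  have fpos: "0 < f i z \<longleftrightarrow> 0 < L i" if "i \<in> I" for i
  proof -
    have "0 < f i z \<longleftrightarrow> (0 :: rat) < of_int (f i z)" by simp
    also have "\<dots> \<longleftrightarrow> 0 < L i" unfolding fz[OF that] using d(1) \<psi>Lpos[OF that] by (simp add: zero_less_mult_iff)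
    finally show ?thesis .
  qed
  show ?thesis
  proof (intro exI[of _ z] conjI ballI impI)
    fix i assume i: "i \<in> I"
    show "0 \<le> f i z"
    proof (cases "L i = 0")
      case True
      then have "of_int (f i z) = (0 :: rat)" using fz[OF i] \<psi>0[OF i] by simp
      then show ?thesis by simp
    next
      case False
      then show ?thesis using fpos[OF i] L0[OF i] by simp
    qed
  next
    have "\<exists>i\<in>I. L i \<noteq> 0" using sumL by (metis sum.neutral zero_neq_one)
    then show "\<exists>i\<in>I. 0 < f i z" using fpos L0 by (metis less_eq_real_def)
  next
    fix i k assume ik: "i \<in> I \<inter> R" "k \<in> I \<inter> R" "0 < f i z" "0 < f k z"
    then have "L i = L k" using fpos by (intro Leq) auto
    then have "\<psi> i = \<psi> k" using ik by (intro \<psi>eq) auto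
    then have "of_int (f i z) = (of_int (f k z) :: rat)" using fz[of i] fz[of k] ik by simp
    then show "f i z = f k z" by simp
  qed
qed

section \<open>Images of matrices in members of minimal idempotents\<close>

lemma lin_form_add_scaled:
  "lin_form v m (\<lambda>j. z j + a * w j) = lin_form v m z + a * lin_form v m w"
  by (simp add: lin_form_def algebra_simps sum.distrib sum_distrib_left)

lemma lin_form_sum:
  "lin_form v m (\<lambda>j. \<Sum>n\<in>F. X n j) = (\<Sum>n\<in>F. lin_form v m (X n))"
  unfolding lin_form_def by (subst sum.swap) (simp add: sum_distrib_left)

text \<open>The hypotheses on \<open>x\<close> pass to subsets of \<open>I\<close>, so the same
  sequence serves throughout the induction. The forms vanishing at \<open>w\<close> are settled
  first; a multiple of \<open>w\<close> then adjusts the rest without disturbing them.\<close>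

lemma lin_forms_in_minimal_idempotent:
  fixes m :: "'i \<Rightarrow> nat \<Rightarrow> int" and x :: "nat \<Rightarrow> nat \<Rightarrow> int" and v :: nat
  defines "f \<equiv> \<lambda>i. lin_form v (m i)"
  assumes min: "left_minimal p" and idem: "beta_plus p p = p"
    and I: "finite I" and A: "A \<in> p"
    and pos: "\<And>n i. i \<in> I \<Longrightarrow> 0 < f i (x n)"
    and dich: "\<And>n i k. i \<in> I \<inter> R \<Longrightarrow> k \<in> I \<inter> R \<Longrightarrow>
      \<bar>ln (real_of_int (f i (x n))) - ln (real_of_int (f k (x n)))\<bar> < 1 / real (n + 1) \<or>
      \<bar>ln (real_of_int (f i (x n))) - ln (real_of_int (f k (x n)))\<bar> > real n"
  shows "\<exists>z. \<forall>i\<in>I. 0 < f i z \<and> (i \<in> R \<longrightarrow> f i z \<in> int ` A)"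
  using I A pos dich
proof (induction I arbitrary: A rule: finite_psubset_induct)
  case (psubset I)
  have p: "p \<in> betaN" using min by (simp add: left_minimal_def)
  note fp = betaN_filter[OF p]
  show ?case
  proof (cases "I = {}")
    case True
    then show ?thesis by simp
  next
    case False
    have "\<exists>w. (\<forall>i\<in>I. 0 \<le> f i w) \<and> (\<exists>i\<in>I. 0 < f i w) \<and>
      (\<forall>i\<in>I \<inter> R. \<forall>k\<in>I \<inter> R. 0 < f i w \<longrightarrow> 0 < f k w \<longrightarrow> f i w = f k w)"
      using psubset.prems(2,3) unfolding f_def by (rule limit_direction[OF psubset.hyps False])
    then obtain w where w: "\<And>i. i \<in> I \<Longrightarrow> 0 \<le> f i w" "\<exists>i\<in>I. 0 < f i w"
      "\<And>i k. i \<in> I \<inter> R \<Longrightarrow> k \<in> I \<inter> R \<Longrightarrow> 0 < f i w \<Longrightarrow> 0 < f k w \<Longrightarrow> f i w = f k w"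
      by metis
    define J where "J = {i \<in> I. f i w = 0}"
    obtain k where "k \<in> I" "0 < f k w" using w(2) by auto
    then have "k \<in> I - J" by (simp add: J_def)
    moreover have "J \<subseteq> I" by (auto simp: J_def)
    ultimately have J: "J \<subset> I" by auto
    have "\<exists>c>0. \<forall>i\<in>I \<inter> R. 0 < f i w \<longrightarrow> f i w = int c"
    proof (cases "\<exists>k\<in>I \<inter> R. 0 < f k w")
      case True
      then obtain k where k: "k \<in> I \<inter> R" "0 < f k w" by auto
      have "\<forall>i\<in>I \<inter> R. 0 < f i w \<longrightarrow> f i w = int (nat (f k w))" using w(3)[OF _ k(1) _ k(2)] k(2) by simp
      then show ?thesis using k(2) by (intro exI[of _ "nat (f k w)"]) auto
    next
      case False
      then show ?thesis by (intro exI[of _ 1]) auto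
    qed
    then obtain c where c: "0 < c" "\<And>i. i \<in> I \<Longrightarrow> i \<in> R \<Longrightarrow> 0 < f i w \<Longrightarrow> f i w = int c" by auto
    define P where "P Y \<longleftrightarrow> (\<exists>z. \<forall>i\<in>J. 0 < f i z \<and> (i \<in> R \<longrightarrow> f i z \<in> int ` Y))" for Y
    have "\<exists>Y. finite Y \<and> Y \<subseteq> B \<and> P Y" if B: "B \<in> p" for B
    proof -
      have "\<exists>z. \<forall>i\<in>J. 0 < f i z \<and> (i \<in> R \<longrightarrow> f i z \<in> int ` B)"
        using J by (intro psubset.IH[OF J B] psubset.prems) auto
      then obtain z where z: "\<forall>i\<in>J. 0 < f i z \<and> (i \<in> R \<longrightarrow> f i z \<in> int ` B)" by auto
      let ?Y = "(\<lambda>i. nat (f i z)) ` (J \<inter> R)"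
      have "finite ?Y" using psubset.hyps J by (meson finite_Int finite_imageI finite_subset psubset_imp_subset)
      moreover have "?Y \<subseteq> B" using z by auto
      moreover have "P ?Y"
        unfolding P_def
      proof (intro exI[of _ z] ballI conjI impI)
        fix i assume i: "i \<in> J"
        show "0 < f i z" using z i by auto
        assume "i \<in> R"
        have "f i z = int (nat (f i z))" using z i by auto
        then show "f i z \<in> int ` ?Y" using i \<open>i \<in> R\<close> by (metis IntI imageI)
      qed
      ultimately show ?thesis by auto
    qed
    moreover have "{s \<in> posN. shift_back (2 * s) posN \<in> p} \<in> p"
      using filter_posN[OF fp] by (simp add: shift_back_posN)
    ultimately obtain Y where Y: "\<And>n. P (Y n)" "FS Y \<subseteq> A"
      using sums_in_idempotent[OF p idem psubset.prems(1), of posN "\<lambda>_. P"] by auto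
    have "\<exists>z. \<forall>i\<in>J. 0 < f i z \<and> (i \<in> R \<longrightarrow> f i z \<in> int ` Y n)" for n using Y(1)[of n] by (simp add: P_def)
    then obtain X where X: "\<And>n i. i \<in> J \<Longrightarrow> 0 < f i (X n)"
      "\<And>n i. i \<in> J \<Longrightarrow> i \<in> R \<Longrightarrow> f i (X n) \<in> int ` Y n" by metis
    \<comment> \<open>\<open>h n\<close> bounds all forms at \<open>X n\<close>. Adding
      \<open>c * h n\<close> makes the values natural numbers, as the van der Waerden theorem
      requires.\<close>
    define h where "h n = nat (\<Sum>i\<in>I. \<bar>f i (X n)\<bar>)" for n
    have h: "\<bar>f i (X n)\<bar> \<le> int (h n)" if "i \<in> I" for i n
    proof -
      have "\<bar>f i (X n)\<bar> \<le> (\<Sum>i\<in>I. \<bar>f i (X n)\<bar>)"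
        by (rule member_le_sum[OF that]) (use psubset.hyps in auto)
      then show ?thesis by (simp add: h_def)
    qed
    define g where "g i n = nat (f i (X n) + int (c * h n))" for i n
    have g: "int (g i n) = f i (X n) + int (c * h n)" if "i \<in> I" for i n
    proof -
      have "h n \<le> c * h n" using c(1) by (cases c) auto
      then have "int (h n) \<le> int (c * h n)" by (simp only: of_nat_le_iff)
      then have "0 \<le> f i (X n) + int (c * h n)" using h[OF that, of n] by linarith
      then show ?thesis by (simp add: g_def)
    qed
    have D: "A \<inter> {n \<in> posN. c dvd n} \<in> p"
      by (rule filter_Int[OF fp psubset.prems(1) multiples_in_idempotent[OF p idem c(1)]])
    \<comment> \<open>The additional map \<open>c * h n\<close>, together with the multiples of
      \<open>c\<close> in the target set, forces \<open>c\<close> to divide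
      \<open>b\<close>.\<close>
    have "finite (insert (\<lambda>n. c * h n) (g ` I))" using psubset.hyps by simp
    then obtain F b where F: "finite F" "F \<noteq> {}" and b: "b \<in> posN"
      "\<And>k. k \<in> insert (\<lambda>n. c * h n) (g ` I) \<Longrightarrow> b + sum k F \<in> A \<inter> {n \<in> posN. c dvd n}"
      by (rule IP_van_der_Waerden_minimal[OF min D]) metis
    have "c dvd b + (\<Sum>n\<in>F. c * h n)" using b(2)[of "\<lambda>n. c * h n"] by simp
    then have "c dvd b" by (simp add: sum_distrib_left[symmetric] dvd_add_left_iff)
    then obtain a0 where a0: "b = c * a0" ..
    have "0 < a0" using b(1) a0 by (cases a0) (auto simp: posN_def)
    \<comment> \<open>On forms with value \<open>c\<close> at \<open>w\<close>, the term
      \<open>sum h F\<close> restores exactly the added \<open>c * h n\<close>, and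
      \<open>a0\<close> contributes \<open>b\<close>. Since \<open>a\<close> exceeds
      \<open>sum h F\<close>, all remaining forms become positive.\<close>
    define a where "a = a0 + sum h F"
    define z where "z j = (\<Sum>n\<in>F. X n j) + int a * w j" for j
    have fz: "f i z = (\<Sum>n\<in>F. f i (X n)) + int a * f i w" for i
      unfolding z_def f_def lin_form_add_scaled lin_form_sum ..
    have "0 < f i z \<and> (i \<in> R \<longrightarrow> f i z \<in> int ` A)" if i: "i \<in> I" for i
    proof (cases "i \<in> J")
      case True
      then have fz': "f i z = (\<Sum>n\<in>F. f i (X n))" by (simp add: fz J_def)
      have "0 < f i z" unfolding fz' using F X(1) True by (intro sum_pos) auto
      moreover have "f i z \<in> int ` A" if "i \<in> R"
      proof -
        have "\<forall>n. \<exists>y. y \<in> Y n \<and> f i (X n) = int y" using X(2)[OF True that] by auto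
        then obtain y where y: "\<And>n. y n \<in> Y n" "\<And>n. f i (X n) = int (y n)" by metis
        have "sum y F \<in> FS Y" using y(1) F by (auto simp: FS_def Pf_def)
        then have "sum y F \<in> A" using Y(2) by auto
        moreover have "f i z = int (sum y F)" unfolding fz' by (simp add: y(2))
        ultimately show ?thesis by (metis imageI)
      qed
      ultimately show ?thesis by simp
    next
      case False
      then have fw: "1 \<le> f i w" using w(1)[OF i] i by (simp add: J_def)
      have "\<bar>\<Sum>n\<in>F. f i (X n)\<bar> \<le> (\<Sum>n\<in>F. int (h n))"
        by (rule order_trans[OF sum_abs sum_mono]) (rule h[OF i])
      also have "\<dots> < int a" using \<open>0 < a0\<close> by (simp add: a_def)
      also have "\<dots> \<le> int a * f i w" using fw by (simp add: mult_le_cancel_left1)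
      finally have "0 < f i z" unfolding fz by linarith
      moreover have "f i z \<in> int ` A" if "i \<in> R"
      proof -
        have "f i w = int c" using c(2) i that fw by simp
        then have "f i z = (\<Sum>n\<in>F. f i (X n)) + int c * int a0 + int c * (\<Sum>n\<in>F. int (h n))"
          by (simp add: fz a_def algebra_simps)
        also have "\<dots> = int b + (\<Sum>n\<in>F. f i (X n) + int (c * h n))"
          by (simp add: a0 sum.distrib sum_distrib_left)
        also have "\<dots> = int (b + sum (g i) F)" by (simp only: of_nat_add of_nat_sum g[OF i])
        finally have "f i z = int (b + sum (g i) F)" .
        moreover have "b + sum (g i) F \<in> A" using b(2)[of "g i"] i by simp
        ultimately show ?thesis by (metis imageI)
      qed
      ultimately show ?thesis by simp
    qed
    then show ?thesis by auto
  qed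
qed

section \<open>Logarithmic colourings and images of rational matrices\<close>

text \<open>Equal floors put \<open>s\<close> and \<open>t\<close> within 1/N. Unequal congruent
  floors differ by at least the square of \<open>N\<close>, and dividing by \<open>N\<close> leaves
  more than N - 1.\<close>

lemma log_colour_dichotomy:
  fixes s t :: real and N :: nat
  assumes "0 < N" "\<lfloor>N * s\<rfloor> mod (int N)\<^sup>2 = \<lfloor>N * t\<rfloor> mod (int N)\<^sup>2"
  shows "\<bar>s - t\<bar> < 1 / N \<or> \<bar>s - t\<bar> > real N - 1"
proof (cases "\<lfloor>N * s\<rfloor> = \<lfloor>N * t\<rfloor>")
  case True
  then have "\<bar>N * s - N * t\<bar> < 1" by linarith
  then have "N * \<bar>s - t\<bar> < 1" using assms(1) by (simp add: abs_mult right_diff_distrib[symmetric])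
  then show ?thesis using assms(1) by (simp add: field_simps)
next
  case False
  have "(int N)\<^sup>2 dvd \<lfloor>N * s\<rfloor> - \<lfloor>N * t\<rfloor>" using assms(2) by (simp add: mod_eq_dvd_iff)
  then have "(int N)\<^sup>2 \<le> \<bar>\<lfloor>N * s\<rfloor> - \<lfloor>N * t\<rfloor>\<bar>" using False dvd_imp_le_int[of "\<lfloor>N * s\<rfloor> - \<lfloor>N * t\<rfloor>" "(int N)\<^sup>2"] by simp
  then have "real_of_int ((int N)\<^sup>2) \<le> real_of_int \<bar>\<lfloor>N * s\<rfloor> - \<lfloor>N * t\<rfloor>\<bar>" by linarith
  moreover have "real_of_int \<bar>\<lfloor>N * s\<rfloor> - \<lfloor>N * t\<rfloor>\<bar> < \<bar>N * s - N * t\<bar> + 1" by linarith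
  ultimately have "(real N)\<^sup>2 - 1 < \<bar>N * s - N * t\<bar>" by simp
  also have "\<dots> = N * \<bar>s - t\<bar>" by (simp add: abs_mult right_diff_distrib[symmetric])
  finally have "(real N)\<^sup>2 - 1 < N * \<bar>s - t\<bar>" .
  moreover have "N * (real N - 1) \<le> (real N)\<^sup>2 - 1" using assms(1) by (simp add: power2_eq_square algebra_simps)
  ultimately have "N * (real N - 1) < N * \<bar>s - t\<bar>" by linarith
  then have "real N - 1 < \<bar>s - t\<bar>" using assms(1) by simp
  then show ?thesis by simp
qed

lemma image_vec_index:
  assumes "i < dim_row M" "x \<in> carrier_vec (dim_col M)"
  shows "image_vec M x $ i = (\<Sum>j<dim_col M. M $$ (i, j) * of_nat (x $ j))"
  using assms by (simp add: image_vec_def scalar_prod_def atLeast0LessThan)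

lemma image_with_log_dichotomy:
  fixes n :: nat
  assumes "image_partition_regular M"
  shows "\<exists>x\<in>posN_vec (dim_col M). \<exists>y. (\<forall>i<dim_row M. 0 < y i \<and> image_vec M x $ i = of_nat (y i)) \<and>
    (\<forall>i<dim_row M. \<forall>k<dim_row M. \<bar>ln (real (y i)) - ln (real (y k))\<bar> < 1 / real (n + 1) \<or>
       \<bar>ln (real (y i)) - ln (real (y k))\<bar> > real n)"
proof -
  define c where "c m = nat (\<lfloor>Suc n * ln (real m)\<rfloor> mod (int (Suc n))\<^sup>2)" for m
  have N: "0 < (int (Suc n))\<^sup>2" by simp
  have "c m \<le> nat ((int (Suc n))\<^sup>2)" for m
    unfolding c_def using pos_mod_bound[OF N] by (intro nat_mono less_imp_le)
  then have "finite (c ` posN)" by (intro finite_subset[OF _ finite_atMost]) auto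
  then obtain x k where x: "x \<in> posN_vec (dim_col M)"
    "\<forall>i<dim_row M. \<exists>m\<in>posN. image_vec M x $ i = of_nat m \<and> c m = k"
    using assms unfolding image_partition_regular_def by metis
  then obtain y where y: "\<And>i. i < dim_row M \<Longrightarrow> y i \<in> posN \<and> image_vec M x $ i = of_nat (y i) \<and> c (y i) = k"
    by metis
  have "\<bar>ln (real (y i)) - ln (real (y j))\<bar> < 1 / real (n + 1) \<or> \<bar>ln (real (y i)) - ln (real (y j))\<bar> > real n"
    if "i < dim_row M" "j < dim_row M" for i j
  proof -
    have "c (y i) = c (y j)" using y that by simp
    then have "\<lfloor>Suc n * ln (real (y i))\<rfloor> mod (int (Suc n))\<^sup>2 = \<lfloor>Suc n * ln (real (y j))\<rfloor> mod (int (Suc n))\<^sup>2"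
      unfolding c_def using pos_mod_sign[OF N] by (simp only: eq_nat_nat_iff)
    then show ?thesis using log_colour_dichotomy[of "Suc n"] by (simp add: add.commute)
  qed
  then show ?thesis using x(1) y by (intro bexI[of _ x] exI[of _ y]) (auto simp: posN_def)
qed

lemma image_in_minimal_idempotent:
  assumes M: "image_partition_regular M" and min: "left_minimal p" and idem: "beta_plus p p = p"
    and A: "A \<in> p"
  shows "\<exists>Y. finite Y \<and> Y \<subseteq> A \<and> Y \<noteq> {} \<and>
    (\<exists>x\<in>posN_vec (dim_col M). of_nat ` Y = vec_set (image_vec M x))"
proof -
  define u where "u = dim_row M"
  define v where "v = dim_col M"
  obtain d a where d: "0 < d" "\<And>e. e \<in> {..<u} \<times> {..<v} \<Longrightarrow> of_int d * M $$ e = of_int (a e)"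
    by (rule common_denominator[of "{..<u} \<times> {..<v}" "\<lambda>e. M $$ e"]) auto
  \<comment> \<open>The left summand indexes the rows of \<open>M\<close> multiplied by
    \<open>d\<close>, the right one the coordinates, which only have to stay positive.\<close>
  define m :: "nat + nat \<Rightarrow> nat \<Rightarrow> int" where
    "m = case_sum (\<lambda>i j. a (i, j)) (\<lambda>k j. of_bool (j = k))"
  define I where "I = (Inl ` {..<u} \<union> Inr ` {..<v} :: (nat + nat) set)"
  have fInl: "of_int (lin_form v (m (Inl i)) (\<lambda>j. int (z $ j))) = of_int d * image_vec M z $ i"
    if "i < u" "z \<in> carrier_vec v" for i z
    using that d(2) by (simp add: lin_form_def m_def image_vec_index u_def v_def sum_distrib_left
        mult.assoc[symmetric])
  have fInr: "lin_form v (m (Inr k)) z = z k" if "k < v" for k z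
    using that sum_unit[of "{..<v}" k z] by (simp add: lin_form_def m_def)
  have "\<forall>n. \<exists>x y. x \<in> posN_vec v \<and> (\<forall>i<u. 0 < y i \<and> image_vec M x $ i = of_nat (y i)) \<and>
    (\<forall>i<u. \<forall>k<u. \<bar>ln (real (y i)) - ln (real (y k))\<bar> < 1 / real (n + 1) \<or>
       \<bar>ln (real (y i)) - ln (real (y k))\<bar> > real n)"
    using image_with_log_dichotomy[OF M] unfolding u_def[symmetric] v_def[symmetric] Bex_def by simp
  then obtain X y where X: "\<And>n. X n \<in> posN_vec v"
    and y: "\<And>n i. i < u \<Longrightarrow> 0 < y n i" "\<And>n i. i < u \<Longrightarrow> image_vec M (X n) $ i = of_nat (y n i)"
    "\<And>n i k. i < u \<Longrightarrow> k < u \<Longrightarrow> \<bar>ln (real (y n i)) - ln (real (y n k))\<bar> < 1 / real (n + 1) \<or>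
       \<bar>ln (real (y n i)) - ln (real (y n k))\<bar> > real n"
    by metis
  have Xc: "X n \<in> carrier_vec v" for n using X[of n] by (simp add: posN_vec_def)
  define x where "x n = (\<lambda>j. int (X n $ j))" for n
  have fx: "lin_form v (m (Inl i)) (x n) = d * int (y n i)" if "i < u" for i n
  proof -
    have "of_int (lin_form v (m (Inl i)) (x n)) = (of_int (d * int (y n i)) :: rat)"
      using fInl[OF that Xc[of n]] y(2)[OF that, of n] by (simp add: x_def)
    then show ?thesis by (simp only: of_int_eq_iff)
  qed
  have "\<exists>z. \<forall>i\<in>I. 0 < lin_form v (m i) z \<and> (i \<in> range Inl \<longrightarrow> lin_form v (m i) z \<in> int ` A)"
  proof (rule lin_forms_in_minimal_idempotent[OF min idem _ A, of I v m x "range Inl"])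
    show "finite I" by (simp add: I_def)
    show "0 < lin_form v (m i) (x n)" if "i \<in> I" for i n
    proof (cases i)
      case (Inl i')
      then show ?thesis using that d(1) y(1)[of i' n] by (auto simp: I_def fx)
    next
      case (Inr k)
      then show ?thesis using that X[of n] by (auto simp: I_def fInr x_def posN_vec_def posN_def)
    qed
    fix n i k assume ik: "i \<in> I \<inter> range Inl" "k \<in> I \<inter> range Inl"
    then obtain i' k' where ik': "i = Inl i'" "i' < u" "k = Inl k'" "k' < u" by (auto simp: I_def)
    \<comment> \<open>The factor \<open>d\<close> shifts all logarithms equally and leaves their
      differences unchanged.\<close>
    have "ln (real_of_int (d * int (y n l))) = ln (real_of_int d) + ln (real (y n l))" if "l < u" for l
      using d(1) y(1)[OF that, of n] by (simp add: ln_mult)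
    then show "\<bar>ln (real_of_int (lin_form v (m i) (x n))) - ln (real_of_int (lin_form v (m k) (x n)))\<bar> < 1 / real (n + 1) \<or>
      \<bar>ln (real_of_int (lin_form v (m i) (x n))) - ln (real_of_int (lin_form v (m k) (x n)))\<bar> > real n"
      using y(3)[OF ik'(2,4), of n] ik' by (simp add: fx)
  qed
  then obtain z where "\<forall>i\<in>I. 0 < lin_form v (m i) z \<and> (i \<in> range Inl \<longrightarrow> lin_form v (m i) z \<in> int ` A)" ..
  then have z: "\<And>i. i \<in> I \<Longrightarrow> 0 < lin_form v (m i) z"
    "\<And>i. i < u \<Longrightarrow> lin_form v (m (Inl i)) z \<in> int ` A" by (simp_all add: I_def)
  have zpos: "0 < z j" if "j < v" for j using z(1)[of "Inr j"] fInr[OF that] that by (simp add: I_def)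
  \<comment> \<open>The factor \<open>d\<close> moves from the matrix to the vector:
    \<open>M\<close> applied to d z equals d M applied to z.\<close>
  define w where "w = vec v (\<lambda>j. nat (d * z j))"
  have w: "w \<in> posN_vec v" using zpos d(1) by (auto simp: w_def posN_vec_def posN_def)
  have img: "image_vec M w $ i = of_int (lin_form v (m (Inl i)) z)" if "i < u" for i
  proof -
    have "image_vec M w $ i = (\<Sum>j<v. M $$ (i, j) * of_nat (w $ j))"
      using that w by (simp add: image_vec_index u_def v_def posN_vec_def)
    also have "\<dots> = (\<Sum>j<v. of_int (a (i, j)) * of_int (z j))"
    proof (rule sum.cong)
      fix j assume j: "j \<in> {..<v}"
      have "of_nat (w $ j) = (of_int (d * z j) :: rat)" using j zpos[of j] d(1) by (simp add: w_def)
      then show "M $$ (i, j) * of_nat (w $ j) = of_int (a (i, j)) * of_int (z j)"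
        using d(2)[of "(i, j)"] j that by (simp add: algebra_simps)
    qed simp
    finally show ?thesis by (simp add: lin_form_def m_def)
  qed
  define Y where "Y = (\<lambda>i. nat (lin_form v (m (Inl i)) z)) ` {..<u}"
  have Y: "finite Y" "Y \<noteq> {}" using M by (auto simp: Y_def u_def image_partition_regular_def lessThan_empty_iff)
  have "nat (lin_form v (m (Inl i)) z) \<in> A" if "i < u" for i using z(2)[OF that] by auto
  then have "Y \<subseteq> A" by (auto simp: Y_def)
  moreover have "of_nat ` Y = vec_set (image_vec M w)"
  proof -
    have "of_nat (nat (lin_form v (m (Inl i)) z)) = image_vec M w $ i" if "i < u" for i
      using z(1)[of "Inl i"] that by (simp add: img I_def)
    moreover have "dim_vec (image_vec M w) = u" by (simp add: image_vec_def u_def)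
    ultimately show ?thesis by (auto simp: Y_def vec_set_def image_image)
  qed
  ultimately show ?thesis using Y w unfolding v_def by metis
qed

section \<open>Doubling an ultrafilter and the final construction\<close>

text \<open>This is 2p, the image of \<open>p\<close> under doubling, not the sum p + p.\<close>

lemma double_in_betaN:
  assumes p: "p \<in> betaN"
  shows "{X. X \<subseteq> posN \<and> {x \<in> posN. 2 * x \<in> X} \<in> p} \<in> betaN" (is "?q \<in> _")
proof -
  note fp = betaN_filter[OF p]
  let ?d = "\<lambda>X. {x \<in> posN. 2 * x \<in> X}"
  have "?d posN = posN" by (auto simp: posN_def)
  then have "posN \<in> ?q" using filter_posN[OF fp] by simp
  moreover have "{} \<notin> ?q" using filter_nonempty[OF fp, of "{}"] by auto
  moreover have "U \<inter> V \<in> ?q" if UV: "U \<in> ?q" "V \<in> ?q" for U V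
  proof -
    have "?d (U \<inter> V) = ?d U \<inter> ?d V" by auto
    then show ?thesis using UV filter_Int[OF fp] by auto
  qed
  moreover have "V \<in> ?q" if UV: "U \<in> ?q" "U \<subseteq> V \<and> V \<subseteq> posN" for U V
  proof -
    have "?d U \<in> p" using UV(1) by simp
    moreover have "?d U \<subseteq> ?d V" "?d V \<subseteq> posN" using UV(2) by auto
    ultimately have "?d V \<in> p" by (rule filter_mono[OF fp])
    then show ?thesis using UV(2) by simp
  qed
  moreover have "U \<in> ?q \<or> posN - U \<in> ?q" if U: "U \<subseteq> posN" for U
  proof -
    have "?d (posN - U) = posN - ?d U" by (auto simp: posN_def)
    moreover have "?d U \<subseteq> posN" by auto
    ultimately have "?d (posN - U) \<in> p \<longleftrightarrow> ?d U \<notin> p"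
      using betaN_Compl_iff[OF p, of "?d U"] by simp
    then show ?thesis using U by simp
  qed
  ultimately show ?thesis unfolding betaN_def by auto
qed

theorem theorem6p6:
  fixes B :: "nat \<Rightarrow> rat mat" and p :: "nat set set" and A :: "nat set"
  assumes "range B = {M. image_partition_regular M}"
    and "minimal_idempotent p"
    and "A \<in> p"
  shows "\<exists>b \<in> posN. \<exists>Y :: nat \<Rightarrow> nat set.
    (\<forall>n. Y n \<in> Pf posN) \<and>
    (\<forall>n. \<exists>x \<in> posN_vec (dim_col (B n)). of_nat ` Y n = vec_set (image_vec (B n) x)) \<and>
    FS Y \<union> (\<lambda>z. b + z) ` MT21 Y \<subseteq> A"
proof -
  have idem: "beta_plus p p = p" and min: "left_minimal p"
    using assms(2) by (auto simp: minimal_idempotent_def K_betaN_eq)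
  have p: "p \<in> betaN" using min by (simp add: left_minimal_def)
  note fp = betaN_filter[OF p]
  define q where "q = {X. X \<subseteq> posN \<and> {x \<in> posN. 2 * x \<in> X} \<in> p}"
  have "q \<in> betaN" unfolding q_def by (rule double_in_betaN[OF p])
  then obtain r where r: "r \<in> betaN" "beta_plus r (beta_plus q p) = p"
    using min by (auto simp: left_minimal_def)
  \<comment> \<open>Since \<open>A\<close> lies in p = r + (q + p), a suitable translate of
    \<open>A\<close> lies in 2p + p; this determines \<open>b\<close>.\<close>
  have "{b \<in> posN. shift_back b A \<in> beta_plus q p} \<in> r" using r(2) assms(3) by (metis mem_beta_plus)
  then have "{b \<in> posN. shift_back b A \<in> beta_plus q p} \<noteq> {}"
    by (rule filter_nonempty[OF betaN_filter[OF r(1)]])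
  then obtain b where b: "b \<in> posN" "shift_back b A \<in> beta_plus q p" by auto
  define C where "C = shift_back b A"
  have "{s \<in> posN. shift_back s C \<in> p} \<in> q" using b(2) by (simp add: mem_beta_plus C_def)
  then have "{x \<in> posN. 2 * x \<in> {s \<in> posN. shift_back s C \<in> p}} \<in> p" by (simp add: q_def)
  then have C: "{s \<in> posN. shift_back (2 * s) C \<in> p} \<in> p"
    by (rule filter_mono[OF fp]) auto
  let ?P = "\<lambda>n Y. Y \<in> Pf posN \<and> (\<exists>x\<in>posN_vec (dim_col (B n)). of_nat ` Y = vec_set (image_vec (B n) x))"
  have "\<exists>Y. finite Y \<and> Y \<subseteq> D \<and> ?P n Y" if D: "D \<in> p" for n D
  proof -
    have "image_partition_regular (B n)" using assms(1) by (metis mem_Collect_eq rangeI)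
    from image_in_minimal_idempotent[OF this min idem D] obtain Y where
      "finite Y" "Y \<subseteq> D" "Y \<noteq> {}"
      and img: "\<exists>x\<in>posN_vec (dim_col (B n)). of_nat ` Y = vec_set (image_vec (B n) x)"
      by (elim exE conjE)
    moreover from this have "Y \<in> Pf posN" using filter_subset[OF fp D] by (simp add: Pf_def)
    ultimately show ?thesis by (intro exI[of _ Y] conjI)
  qed
  then have "\<exists>Y. (\<forall>n. ?P n (Y n)) \<and> FS Y \<subseteq> A \<and> MT21 Y \<subseteq> C"
    by (rule sums_in_idempotent[OF p idem assms(3) C])
  then obtain Y where Y: "\<forall>n. ?P n (Y n)" "FS Y \<subseteq> A" "MT21 Y \<subseteq> C" by (elim exE conjE)
  have "(\<lambda>z. b + z) ` MT21 Y \<subseteq> A" using Y(3) by (auto simp: C_def mem_shift_back)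
  then have "FS Y \<union> (\<lambda>z. b + z) ` MT21 Y \<subseteq> A" using Y(2) by (rule Un_least[rotated])
  moreover have "\<forall>n. Y n \<in> Pf posN"
    "\<forall>n. \<exists>x\<in>posN_vec (dim_col (B n)). of_nat ` Y n = vec_set (image_vec (B n) x)"
    using Y(1) by simp_all
  ultimately show ?thesis using b(1) by (intro bexI[of _ b] exI[of _ Y] conjI)
qed

end
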